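(* Let $G$ be a finite group of order $n$, and let $C_n$ denote the cyclic group of order $n$. Then $\Omega_{\rho}(G) \leq \Omega_{\rho}(C_n)$, with equality if and only if $G$ is cyclic.
   Context: For a finite group $G$, let $o(x)$ denote the order of $x\in G$ and set $\rho(G)=\prod_{x\in G} o(x)$. For a positive integer $m=p_1^{\alpha_1}\cdots p_k^{\alpha_k}$ with $p_1,\dots,p_k$ distinct primes, $\Omega(m)=\alpha_1+\cdots+\alpha_k$ is the number of prime factors of $m$ counted with multiplicity (so $\Omega(1)=0$). Define $\Omega_{\rho}(G)=\Omega(\rho(G))$. *)

theory Defs
  imports "HOL-Algebra.Elementary_Groups" "HOL-Algebra.Multiplicative_Group"
    "HOL-Computational_Algebra.Primes"
begin

definition rho :: "('a, 'b) monoid_scheme \<Rightarrow> nat" where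
  "rho G = (\<Prod>x\<in>carrier G. group.ord G x)"

definition big_Omega :: "nat \<Rightarrow> nat" where
  "big_Omega m = (\<Sum>p\<in>prime_factors m. multiplicity p m)"

definition Omega_rho :: "('a, 'b) monoid_scheme \<Rightarrow> nat" where
  "Omega_rho G = big_Omega (rho G)"

end

theory Submission
  imports Defs "HOL-Number_Theory.Totient" "HOL-Algebra.Sylow"
begin

text \<open>
  Let \<open>n\<close> be the order of \<open>G\<close>, and for a divisor \<open>d\<close> of \<open>n\<close> let \<open>N d\<close> be the number of
  solutions of \<open>x ^ d = 1\<close> in \<open>G\<close>. A prime power \<open>p ^ i \<noteq> 1\<close> that divides \<open>n\<close> divides the order of \<open>x\<close> exactly
  when \<open>x ^ (n / p ^ j) \<noteq> 1\<close>, where \<open>i + j\<close> is one more than the exponent of \<open>p\<close> in \<open>n\<close>.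
  Counting pairs \<open>(x, p ^ i)\<close> therefore gives (\<open>Omega_rho_root_counts\<close>)
  \<open>Omega_rho G = \<Sum>p. \<Sum>j. n - N (n / p ^ j)\<close>, where \<open>p\<close> runs through the primes dividing \<open>n\<close> and \<open>j\<close> from 1 to the
  exponent of \<open>p\<close>. By the theorem of Frobenius, \<open>d\<close> divides \<open>N d\<close>, so \<open>N d \<ge> d\<close>; in the cyclic
  group \<open>N d = d\<close>. This is the inequality, term by term. Frobenius' theorem is proved for the divisors
  \<open>n / p ^ j\<close> only (\<open>frobenius_prime_power_codivisor\<close>), where sorting the elements by their
  \<open>p\<close>-parts suffices.

  If equality holds, then \<open>N (n / p) = n / p\<close> for every prime \<open>p\<close> dividing \<open>n\<close>, and this forces \<open>G\<close> to be
  cyclic (\<open>cyclic_if_root_counts\<close>). As \<open>N (n / p) < n\<close>, some element \<open>w\<close> has order the full power of \<open>p\<close>,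
  so the Sylow subgroups are cyclic. The value of \<open>N (n / p)\<close> also fixes the number of conjugacy classes of such
  elements, and it is so large that distinct generators of \<open>\<langle>w\<rangle>\<close> cannot be conjugate
  (\<open>conj_generators_cyclic_sylow_eq\<close>). By Sylow's conjugacy theorem it follows that a \<open>p\<close>-element that commutes
  with one of its conjugates equals it, and then the same holds for all elements
  (\<open>cyclic_sylow_no_fusion\<close>, \<open>no_fusion_if_no_local_fusion\<close>). A group with this property is abelian
  (\<open>abelian_if_no_fusion\<close>): in a minimal counterexample the centralizers of non-central elements are
  abelian, any two of them are equal or meet in the center, and the conjugates of the non-central elements of a
  single one already fill at least half of the group. They do not fill the complement of the center, and two
  disjoint sets of this kind leave no room for the identity. An abelian group with cyclic Sylow subgroups is cyclic.
\<close>

section \<open>Conjugation and centralizers\<close>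

definition root_count :: "('a, 'b) monoid_scheme \<Rightarrow> nat \<Rightarrow> nat" where
  "root_count G d = card {x \<in> carrier G. x [^]\<^bsub>G\<^esub> d = \<one>\<^bsub>G\<^esub>}"

definition centralizer :: "('a, 'b) monoid_scheme \<Rightarrow> 'a \<Rightarrow> 'a set" where
  "centralizer G u = {g \<in> carrier G. g \<otimes>\<^bsub>G\<^esub> u = u \<otimes>\<^bsub>G\<^esub> g}"

definition center :: "('a, 'b) monoid_scheme \<Rightarrow> 'a set" where
  "center G = {z \<in> carrier G. centralizer G z = carrier G}"

definition conj_by :: "('a, 'b) monoid_scheme \<Rightarrow> 'a \<Rightarrow> 'a \<Rightarrow> 'a" where
  "conj_by G g x = g \<otimes>\<^bsub>G\<^esub> x \<otimes>\<^bsub>G\<^esub> inv\<^bsub>G\<^esub> g"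

definition conj_class :: "('a, 'b) monoid_scheme \<Rightarrow> 'a \<Rightarrow> 'a set" where
  "conj_class G u = (\<lambda>g. conj_by G g u) ` carrier G"

lemma dvd_sum_by_fibres:
  fixes f :: "'a \<Rightarrow> nat"
  assumes "finite U"
    and "\<And>u. u \<in> U \<Longrightarrow> d dvd (\<Sum>v\<in>{v\<in>U. h v = h u}. f v)"
  shows "d dvd sum f U"
proof -
  have "d dvd (\<Sum>v\<in>{v\<in>U. h v = c}. f v)" if "c \<in> h ` U" for c
    using that assms(2) by (elim imageE) (simp only:)
  hence "d dvd (\<Sum>c\<in>h ` U. \<Sum>v\<in>{v\<in>U. h v = c}. f v)"
    by (rule dvd_sum)
  thus ?thesis
    by (subst sum.image_gen[OF assms(1), of f h])
qed

context group
begin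

lemma inv_mult_cancel_left [simp]:
  assumes "g \<in> carrier G" "x \<in> carrier G"
  shows "inv g \<otimes> (g \<otimes> x) = x" "g \<otimes> (inv g \<otimes> x) = x"
  using assms by (simp_all flip: m_assoc)

lemma conj_by_closed [simp]:
  "g \<in> carrier G \<Longrightarrow> x \<in> carrier G \<Longrightarrow> conj_by G g x \<in> carrier G"
  by (simp add: conj_by_def)

lemma conj_by_mult:
  "g \<in> carrier G \<Longrightarrow> h \<in> carrier G \<Longrightarrow> x \<in> carrier G \<Longrightarrow>
    conj_by G g (conj_by G h x) = conj_by G (g \<otimes> h) x"
  by (simp add: conj_by_def inv_mult_group m_assoc)

lemma conj_by_one [simp]: "x \<in> carrier G \<Longrightarrow> conj_by G \<one> x = x"
  by (simp add: conj_by_def)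

lemma conj_by_hom:
  "g \<in> carrier G \<Longrightarrow> x \<in> carrier G \<Longrightarrow> y \<in> carrier G \<Longrightarrow>
    conj_by G g (x \<otimes> y) = conj_by G g x \<otimes> conj_by G g y"
  by (simp add: conj_by_def m_assoc)

lemma conj_by_inv_cancel [simp]:
  "g \<in> carrier G \<Longrightarrow> x \<in> carrier G \<Longrightarrow> conj_by G (inv g) (conj_by G g x) = x"
  "g \<in> carrier G \<Longrightarrow> x \<in> carrier G \<Longrightarrow> conj_by G g (conj_by G (inv g) x) = x"
  by (simp_all add: conj_by_mult)

lemma conj_by_eq_iff:
  "g \<in> carrier G \<Longrightarrow> x \<in> carrier G \<Longrightarrow> y \<in> carrier G \<Longrightarrow>
    conj_by G g x = conj_by G g y \<longleftrightarrow> x = y"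
  by (metis conj_by_inv_cancel(1))

lemma conj_by_of_one [simp]: "g \<in> carrier G \<Longrightarrow> conj_by G g \<one> = \<one>"
  by (simp add: conj_by_def)

lemma conj_by_pow:
  "g \<in> carrier G \<Longrightarrow> x \<in> carrier G \<Longrightarrow> conj_by G g (x [^] (n::nat)) = conj_by G g x [^] n"
  by (induction n) (simp_all add: conj_by_hom)

lemma conj_by_id_iff:
  "g \<in> carrier G \<Longrightarrow> x \<in> carrier G \<Longrightarrow> conj_by G g x = x \<longleftrightarrow> g \<in> centralizer G x"
  unfolding conj_by_def centralizer_def mem_Collect_eq by (metis inv_solve_right m_closed)

lemma centralizer_sym:
  "x \<in> carrier G \<Longrightarrow> y \<in> carrier G \<Longrightarrow> x \<in> centralizer G y \<longleftrightarrow> y \<in> centralizer G x"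
  by (auto simp: centralizer_def)

lemma conj_by_centralizer:
  assumes "g \<in> carrier G" "x \<in> carrier G" "y \<in> carrier G"
  shows "conj_by G g x \<in> centralizer G (conj_by G g y) \<longleftrightarrow> x \<in> centralizer G y"
  using assms by (simp add: centralizer_def conj_by_eq_iff flip: conj_by_hom)

lemma conj_by_pow_eq_one_iff:
  "g \<in> carrier G \<Longrightarrow> x \<in> carrier G \<Longrightarrow> conj_by G g x [^] (n::nat) = \<one> \<longleftrightarrow> x [^] n = \<one>"
  using conj_by_eq_iff[of g "x [^] n" \<one>] by (simp add: conj_by_pow)

lemma subgroup_centralizer:
  assumes "u \<in> carrier G" shows "subgroup (centralizer G u) G"
proof (rule subgroupI)
  fix a assume a: "a \<in> centralizer G u"
  have "conj_by G a u = u" using a assms conj_by_id_iff by (auto simp: centralizer_def)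
  hence "conj_by G (inv a) u = u"
    using conj_by_inv_cancel(1)[of a u] a assms by (auto simp: centralizer_def)
  thus "inv a \<in> centralizer G u"
    using a assms conj_by_id_iff[of "inv a" u] by (auto simp: centralizer_def)
next
  fix a b assume "a \<in> centralizer G u" "b \<in> centralizer G u"
  thus "a \<otimes> b \<in> centralizer G u"
    using assms by (auto simp: centralizer_def) (metis m_assoc)
next
  have "\<one> \<in> centralizer G u" using assms by (simp add: centralizer_def)
  thus "centralizer G u \<noteq> {}" by blast
qed (auto simp: centralizer_def)

lemma mem_center_iff:
  "z \<in> center G \<longleftrightarrow> z \<in> carrier G \<and> (\<forall>g\<in>carrier G. z \<in> centralizer G g)"
proof -
  have "centralizer G z \<subseteq> carrier G" by (auto simp: centralizer_def)
  thus ?thesis unfolding center_def mem_Collect_eq using centralizer_sym[of z] by blast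
qed

lemma subgroup_center: "subgroup (center G) G"
proof (rule subgroupI)
  have "\<one> \<in> center G" by (simp add: mem_center_iff centralizer_def)
  thus "center G \<noteq> {}" by blast
next
  fix a assume "a \<in> center G"
  thus "inv a \<in> center G"
    using subgroup.m_inv_closed[OF subgroup_centralizer] by (simp add: mem_center_iff)
next
  fix a b assume "a \<in> center G" "b \<in> center G"
  thus "a \<otimes> b \<in> center G"
    using subgroup.m_closed[OF subgroup_centralizer] by (simp add: mem_center_iff)
qed (auto simp: mem_center_iff)

lemma conj_by_mem_center_imp:
  assumes "g \<in> carrier G" "u \<in> carrier G" "conj_by G g u \<in> center G"
  shows "u \<in> center G"
proof -
  have "u \<in> centralizer G x" if "x \<in> carrier G" for x
    using conj_by_centralizer[of g u x] assms that by (simp add: mem_center_iff)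
  thus ?thesis using assms by (simp add: mem_center_iff)
qed

lemma pow_mem_centralizer:
  assumes "x \<in> carrier G" "y \<in> centralizer G x"
  shows "y [^] (n::nat) \<in> centralizer G x" "x \<in> centralizer G (y [^] n)"
proof -
  interpret C: group "G\<lparr>carrier := centralizer G x\<rparr>"
    by (rule subgroup_imp_group[OF subgroup_centralizer[OF assms(1)]])
  show "y [^] n \<in> centralizer G x"
    using C.nat_pow_closed[of y n] assms(2) nat_pow_consistent[of y n "centralizer G x"] by simp
  thus "x \<in> centralizer G (y [^] n)"
    using assms by (subst centralizer_sym) (auto simp: centralizer_def)
qed

lemma centralizer_group:
  "u \<in> carrier G \<Longrightarrow> group (G\<lparr>carrier := centralizer G u\<rparr>)"
  using subgroup_imp_group subgroup_centralizer by blast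

lemma root_count_subgroup:
  "root_count (G\<lparr>carrier := H\<rparr>) d = card {x \<in> H. x [^] d = \<one>}"
  by (simp add: root_count_def flip: nat_pow_consistent)

text \<open>
  The common core of Lagrange's theorem and the orbit-stabilizer theorem: the fibres of \<open>f\<close> are the left
  cosets of \<open>S\<close>. Applied below to the maps \<open>g \<mapsto> g u g^-1\<close>, \<open>g \<mapsto> g P\<close> and \<open>k \<mapsto> k c\<close>.
\<close>

lemma card_image_times_fibre:
  assumes "finite (carrier G)" "S \<subseteq> carrier G"
    and "\<And>g h. g \<in> carrier G \<Longrightarrow> h \<in> carrier G \<Longrightarrow> f g = f h \<longleftrightarrow> inv g \<otimes> h \<in> S"
  shows "card (f ` carrier G) * card S = order G"
proof -
  have fibre: "card {h \<in> carrier G. f h = f g} = card S" if g: "g \<in> carrier G" for g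
  proof -
    have "{h \<in> carrier G. f h = f g} = (\<lambda>s. g \<otimes> s) ` S"
    proof (intro equalityI subsetI)
      fix h assume "h \<in> {h \<in> carrier G. f h = f g}"
      hence h: "h \<in> carrier G" "inv g \<otimes> h \<in> S" using assms(3)[OF g, of h] by auto
      have "h = g \<otimes> (inv g \<otimes> h)" using g h by (simp flip: m_assoc)
      thus "h \<in> (\<lambda>s. g \<otimes> s) ` S" using h by blast
    next
      fix h assume "h \<in> (\<lambda>s. g \<otimes> s) ` S"
      then obtain s where s: "s \<in> S" "h = g \<otimes> s" by auto
      have "s \<in> carrier G" using s assms(2) by auto
      thus "h \<in> {h \<in> carrier G. f h = f g}"
        using g s assms(3)[of g h] by (simp flip: m_assoc)
    qed
    moreover have "inj_on (\<lambda>s. g \<otimes> s) S" using g assms(2) by (intro inj_onI) (metis inv_mult_cancel_left(1) subsetD)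
    ultimately show ?thesis by (simp add: card_image)
  qed
  have "order G = (\<Sum>g\<in>carrier G. 1)" by (simp add: order_def)
  also have "\<dots> = (\<Sum>c\<in>f ` carrier G. \<Sum>h\<in>{h \<in> carrier G. f h = c}. 1)"
    using assms(1) by (rule sum.image_gen)
  also have "\<dots> = (\<Sum>c\<in>f ` carrier G. card S)"
    using fibre by (intro sum.cong) auto
  finally show ?thesis by simp
qed

lemma card_conj_class:
  assumes "finite (carrier G)" "u \<in> carrier G"
  shows "card (conj_class G u) * card (centralizer G u) = order G"
  unfolding conj_class_def
proof (rule card_image_times_fibre[OF assms(1)])
  fix g h assume gh: "g \<in> carrier G" "h \<in> carrier G"
  have "conj_by G g u = conj_by G h u \<longleftrightarrow> u = conj_by G (inv g) (conj_by G h u)"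
    using gh assms by (metis conj_by_closed conj_by_inv_cancel inv_closed)
  also have "\<dots> \<longleftrightarrow> inv g \<otimes> h \<in> centralizer G u"
    using gh assms conj_by_id_iff[of "inv g \<otimes> h" u] by (auto simp: conj_by_mult)
  finally show "conj_by G g u = conj_by G h u \<longleftrightarrow> inv g \<otimes> h \<in> centralizer G u" .
qed (auto simp: centralizer_def)

lemma conj_class_subset: "u \<in> carrier G \<Longrightarrow> conj_class G u \<subseteq> carrier G"
  by (auto simp: conj_class_def)

lemma conj_class_self: "u \<in> carrier G \<Longrightarrow> u \<in> conj_class G u"
  unfolding conj_class_def by (rule image_eqI[of _ _ \<one>]) simp_all

lemma conj_class_eq_iff:
  assumes "u \<in> carrier G" "v \<in> carrier G"
  shows "conj_class G v = conj_class G u \<longleftrightarrow> v \<in> conj_class G u"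
proof
  assume "v \<in> conj_class G u"
  then obtain g where g: "g \<in> carrier G" "v = conj_by G g u" by (auto simp: conj_class_def)
  show "conj_class G v = conj_class G u"
  proof (intro equalityI subsetI)
    fix x assume "x \<in> conj_class G v"
    then obtain h where "h \<in> carrier G" "x = conj_by G h v" by (auto simp: conj_class_def)
    thus "x \<in> conj_class G u"
      unfolding conj_class_def using g assms
      by (intro image_eqI[of _ _ "h \<otimes> g"]) (simp_all add: conj_by_mult)
  next
    fix x assume "x \<in> conj_class G u"
    then obtain h where "h \<in> carrier G" "x = conj_by G h u" by (auto simp: conj_class_def)
    thus "x \<in> conj_class G v"
      unfolding conj_class_def using g assms
      by (intro image_eqI[of _ _ "h \<otimes> inv g"]) (simp_all flip: conj_by_mult)
  qed
qed (metis conj_class_self assms(2))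

lemma root_count_centralizer_conj:
  assumes "finite (carrier G)" "g \<in> carrier G" "u \<in> carrier G"
  shows "root_count (G\<lparr>carrier := centralizer G (conj_by G g u)\<rparr>) d
       = root_count (G\<lparr>carrier := centralizer G u\<rparr>) d"
proof -
  have "bij_betw (conj_by G g) {x \<in> centralizer G u. x [^] d = \<one>}
          {x \<in> centralizer G (conj_by G g u). x [^] d = \<one>}"
  proof (rule bij_betw_byWitness[where f' = "conj_by G (inv g)"])
    show "conj_by G g ` {x \<in> centralizer G u. x [^] d = \<one>}
            \<subseteq> {x \<in> centralizer G (conj_by G g u). x [^] d = \<one>}"
      using assms conj_by_centralizer[of g _ u] conj_by_pow_eq_one_iff[of g]
      by (auto simp: centralizer_def)
    show "conj_by G (inv g) ` {x \<in> centralizer G (conj_by G g u). x [^] d = \<one>}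
            \<subseteq> {x \<in> centralizer G u. x [^] d = \<one>}"
    proof
      fix y assume "y \<in> conj_by G (inv g) ` {x \<in> centralizer G (conj_by G g u). x [^] d = \<one>}"
      then obtain x where x: "x \<in> centralizer G (conj_by G g u)" "x [^] d = \<one>"
        "y = conj_by G (inv g) x" by auto
      have xc: "x \<in> carrier G" using x by (simp add: centralizer_def)
      show "y \<in> {x \<in> centralizer G u. x [^] d = \<one>}"
        using x xc assms conj_by_centralizer[of "inv g" x "conj_by G g u"]
          conj_by_pow_eq_one_iff[of "inv g" x] by simp
    qed
  qed (use assms in \<open>auto simp: centralizer_def\<close>)
  thus ?thesis by (simp add: root_count_subgroup bij_betw_same_card)
qed

text \<open>
  A class function sums to \<open>card (conj_class G u) * f u\<close> over the class of \<open>u\<close>, and \<open>U\<close> is a disjoint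
  union of classes.
\<close>

lemma dvd_sum_over_classes:
  fixes f :: "'a \<Rightarrow> nat"
  assumes "finite (carrier G)" "U \<subseteq> carrier G"
    and "\<And>g u. g \<in> carrier G \<Longrightarrow> u \<in> U \<Longrightarrow> conj_by G g u \<in> U"
    and "\<And>g u. g \<in> carrier G \<Longrightarrow> u \<in> U \<Longrightarrow> f (conj_by G g u) = f u"
    and "\<And>u. u \<in> U \<Longrightarrow> d dvd card (conj_class G u) * f u"
  shows "d dvd sum f U"
proof (rule dvd_sum_by_fibres[where h = "conj_class G"])
  show "finite U" using assms(1,2) finite_subset by blast
  fix u assume u: "u \<in> U"
  have "conj_class G u \<subseteq> U" using u assms(3) by (auto simp: conj_class_def)
  hence "{v\<in>U. conj_class G v = conj_class G u} = conj_class G u"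
    using u assms(2) conj_class_eq_iff by blast
  moreover have "sum f (conj_class G u) = (\<Sum>v\<in>conj_class G u. f u)"
    using u assms(4) by (intro sum.cong) (auto simp: conj_class_def)
  ultimately show "d dvd (\<Sum>v\<in>{v\<in>U. conj_class G v = conj_class G u}. f v)"
    using assms(5)[OF u] by simp
qed

end

section \<open>Sorting the elements by their p-parts\<close>

text \<open>
  With \<open>q\<close> the \<open>p\<close>-part of the group order and \<open>m\<close> its cofactor, the exponent \<open>e = m * s = q * t + 1\<close> makes
  \<open>x \<mapsto> x ^ e\<close> the projection of an element onto its \<open>p\<close>-part: it kills elements of order dividing \<open>m\<close> and
  fixes those of order dividing \<open>q\<close>.
\<close>

lemma prime_power_part_exponent:
  fixes q m :: nat
  assumes "coprime q m" "m > 0"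
  obtains s t where "m * s = q * t + 1"
proof -
  obtain s t where "m * s = q * t + gcd m q"
    using bezout_nat[of m q] assms(2) by auto
  thus thesis
    using that assms(1) by (simp add: coprime_iff_gcd_eq_1 gcd.commute)
qed

lemma prime_power_dvd_of_new_divisor:
  fixes p m d :: nat
  assumes p: "prime p" and "d dvd p ^ Suc k * m" "\<not> d dvd p ^ k * m"
  shows "p ^ Suc k dvd d"
proof (rule ccontr)
  assume nd: "\<not> p ^ Suc k dvd d"
  have "d \<noteq> 0" using nd by (metis dvd_0_right)
  then obtain r where r: "d = p ^ multiplicity p d * r" "\<not> p dvd r"
    using multiplicity_decompose'[OF \<open>d \<noteq> 0\<close>, of p] p not_prime_unit by metis
  have "multiplicity p d \<le> k"
    using nd \<open>d \<noteq> 0\<close> p by (meson multiplicity_dvd' not_less_eq_eq)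
  moreover have "coprime r (p ^ Suc k)"
    using r p by (metis coprime_commute coprime_power_right_iff prime_imp_coprime)
  hence "r dvd m"
    using assms(2) r(1) by (metis coprime_dvd_mult_right_iff dvd_mult_right)
  ultimately have "d dvd p ^ k * m"
    by (subst r(1)) (intro mult_dvd_mono le_imp_power_dvd)
  thus False using assms(3) by blast
qed

context group
begin

text \<open>
  An element that projects onto \<open>u\<close> commutes with its power \<open>u\<close>, and dividing it by \<open>u\<close> leaves a solution of
  \<open>w ^ m = 1\<close> in the centralizer of \<open>u\<close>. Conversely, \<open>w u\<close> projects onto \<open>u\<close> for every such \<open>w\<close>.
\<close>

lemma card_fibre_of_part:
  assumes "finite (carrier G)" "order G dvd q * m" "m * s = q * t + 1"
    and u: "u \<in> carrier G" "u [^] q = \<one>"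
  shows "card {x \<in> carrier G. x [^] (m * s) = u} = root_count (G\<lparr>carrier := centralizer G u\<rparr>) m"
proof -
  have exp: "x [^] (q * m) = \<one>" if "x \<in> carrier G" for x
    using that assms(2) by (metis dvd_trans ord_dvd_group_order pow_eq_id)
  have "bij_betw (\<lambda>x. x \<otimes> inv u) {x \<in> carrier G. x [^] (m * s) = u}
          {w \<in> centralizer G u. w [^] m = \<one>}"
  proof (rule bij_betw_byWitness[where f' = "\<lambda>w. w \<otimes> u"])
    show "(\<lambda>x. x \<otimes> inv u) ` {x \<in> carrier G. x [^] (m * s) = u} \<subseteq> {w \<in> centralizer G u. w [^] m = \<one>}"
    proof (intro image_subsetI)
      fix x assume "x \<in> {x \<in> carrier G. x [^] (m * s) = u}"
      hence x: "x \<in> carrier G" "x [^] (m * s) = u" by auto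
      have "x \<in> centralizer G x" using x by (simp add: centralizer_def)
      hence xu: "x \<in> centralizer G u" using pow_mem_centralizer(2)[OF x(1), of x "m * s"] x by simp
      note C = subgroup_centralizer[OF u(1)]
      have "u \<in> centralizer G u" using u by (simp add: centralizer_def)
      hence w: "x \<otimes> inv u \<in> centralizer G u"
        using subgroup.m_closed[OF C xu] subgroup.m_inv_closed[OF C] by blast
      have "inv u \<in> centralizer G x"
        using xu u x subgroup.m_inv_closed[OF subgroup_centralizer[OF x(1)], of u] centralizer_sym by auto
      hence comm: "x \<otimes> inv u = inv u \<otimes> x" by (simp add: centralizer_def)
      have "u [^] m = x [^] (m * s * m)" using x by (metis nat_pow_pow)
      also have "m * s * m = m + q * m * t" by (simp add: assms(3) algebra_simps)
      also have "x [^] \<dots> = x [^] m" using exp[OF x(1)] x(1)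
        by (simp flip: nat_pow_mult nat_pow_pow)
      finally have "(x \<otimes> inv u) [^] m = \<one>"
        using comm x u by (simp add: pow_mult_distrib nat_pow_inv)
      thus "x \<otimes> inv u \<in> {w \<in> centralizer G u. w [^] m = \<one>}" using w by simp
    qed
    show "(\<lambda>w. w \<otimes> u) ` {w \<in> centralizer G u. w [^] m = \<one>} \<subseteq> {x \<in> carrier G. x [^] (m * s) = u}"
    proof (intro image_subsetI)
      fix w assume "w \<in> {w \<in> centralizer G u. w [^] m = \<one>}"
      hence w: "w \<in> carrier G" "w \<otimes> u = u \<otimes> w" "w [^] m = \<one>" by (auto simp: centralizer_def)
      have "(w \<otimes> u) [^] (m * s) = w [^] (m * s) \<otimes> u [^] (m * s)"
        using w u by (intro pow_mult_distrib)
      also have "w [^] (m * s) = \<one>" using w by (simp flip: nat_pow_pow)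
      also have "u [^] (m * s) = u"
        unfolding assms(3) using u by (simp flip: nat_pow_mult nat_pow_pow)
      finally show "w \<otimes> u \<in> {x \<in> carrier G. x [^] (m * s) = u}" using w u by simp
    qed
    have "w \<otimes> u \<otimes> inv u = w" if "w \<in> carrier G" for w
      using that u by (simp add: m_assoc)
    thus "\<forall>w\<in>{w \<in> centralizer G u. w [^] m = \<one>}. w \<otimes> u \<otimes> inv u = w"
      unfolding centralizer_def by blast
  qed (use u in \<open>simp add: m_assoc\<close>)
  thus ?thesis by (simp add: root_count_subgroup bij_betw_same_card)
qed

lemma card_by_parts:
  assumes "finite (carrier G)" "order G dvd q * m" "m * s = q * t + 1"
    and "U \<subseteq> {u \<in> carrier G. u [^] q = \<one>}"
  shows "card {x \<in> carrier G. x [^] (m * s) \<in> U}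
       = (\<Sum>u\<in>U. root_count (G\<lparr>carrier := centralizer G u\<rparr>) m)"
proof -
  have fin: "finite U" using assms(1,4) finite_subset by fastforce
  have "{x \<in> carrier G. x [^] (m * s) \<in> U} = (\<Union>u\<in>U. {x \<in> carrier G. x [^] (m * s) = u})"
    by auto
  also have "card \<dots> = (\<Sum>u\<in>U. card {x \<in> carrier G. x [^] (m * s) = u})"
    using fin assms(1) by (intro card_UN_disjoint) auto
  also have "\<dots> = (\<Sum>u\<in>U. root_count (G\<lparr>carrier := centralizer G u\<rparr>) m)"
    using assms by (intro sum.cong refl card_fibre_of_part) auto
  finally show ?thesis .
qed

lemma part_pow_eq_one_iff:
  assumes "order G dvd q * m" "m * s = q * t + 1" "x \<in> carrier G"
  shows "(x [^] (m * s)) [^] d = \<one> \<longleftrightarrow> x [^] (d * m) = \<one>"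
proof
  assume "x [^] (d * m) = \<one>"
  hence "(x [^] (d * m)) [^] s = \<one>" by simp
  thus "(x [^] (m * s)) [^] d = \<one>" using assms(3) by (simp add: nat_pow_pow mult_ac)
next
  assume "(x [^] (m * s)) [^] d = \<one>"
  hence "((x [^] (m * s)) [^] d) [^] m = \<one>" by simp
  hence "x [^] (d * m * (m * s)) = \<one>" using assms(3) by (simp add: nat_pow_pow mult_ac)
  moreover have "d * m * (m * s) = d * m + (q * m) * (d * t)" by (simp add: assms(2) algebra_simps)
  moreover have "x [^] (q * m) = \<one>"
    using assms by (metis dvd_trans ord_dvd_group_order pow_eq_id)
  ultimately show "x [^] (d * m) = \<one>"
    using assms(3) by (simp flip: nat_pow_mult nat_pow_pow)
qed

text \<open>
  The class of \<open>u\<close> contributes its size, the index of the centralizer, times the number of roots in the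
  centralizer. If the latter is divisible by the \<open>p\<close>-free part of the order of the centralizer, the product is
  divisible by that of the order of \<open>G\<close>.
\<close>

lemma dvd_sum_centralizer_roots:
  assumes fin: "finite (carrier G)" and p: "prime (p::nat)" and m': "m' dvd order G" "coprime p m'"
    and U: "U \<subseteq> carrier G" "\<And>g u. g \<in> carrier G \<Longrightarrow> u \<in> U \<Longrightarrow> conj_by G g u \<in> U"
    and C: "\<And>u r. u \<in> U \<Longrightarrow> coprime p r \<Longrightarrow> r dvd card (centralizer G u) \<Longrightarrow>
              r dvd root_count (G\<lparr>carrier := centralizer G u\<rparr>) m"
  shows "m' dvd (\<Sum>u\<in>U. root_count (G\<lparr>carrier := centralizer G u\<rparr>) m)"
proof (rule dvd_sum_over_classes[OF fin U])
  fix g u assume "g \<in> carrier G" "u \<in> U"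
  thus "root_count (G\<lparr>carrier := centralizer G (conj_by G g u)\<rparr>) m
      = root_count (G\<lparr>carrier := centralizer G u\<rparr>) m"
    using fin U by (intro root_count_centralizer_conj) auto
next
  fix u assume u: "u \<in> U"
  have cl: "card (conj_class G u) * card (centralizer G u) = order G"
    using fin u U by (intro card_conj_class) auto
  have "card (centralizer G u) \<noteq> 0" using cl fin order_gt_0_iff_finite by (metis mult_0_right not_gr0)
  then obtain r where r: "card (centralizer G u) = p ^ multiplicity p (card (centralizer G u)) * r"
    "\<not> p dvd r"
    using multiplicity_decompose'[of "card (centralizer G u)" p] p not_prime_unit by metis
  have cop: "coprime p r" using r p by (simp add: prime_imp_coprime)
  have "m' dvd p ^ multiplicity p (card (centralizer G u)) * (card (conj_class G u) * r)"
    using m'(1) cl r(1) by (metis mult.assoc mult.commute)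
  hence "m' dvd card (conj_class G u) * r"
    using m'(2) by (metis coprime_commute coprime_dvd_mult_right_iff coprime_power_right_iff)
  moreover have "r dvd root_count (G\<lparr>carrier := centralizer G u\<rparr>) m"
    using C[OF u cop] r(1) by (metis dvd_triv_right)
  ultimately show "m' dvd card (conj_class G u) * root_count (G\<lparr>carrier := centralizer G u\<rparr>) m"
    by (meson dvd_refl dvd_trans mult_dvd_mono)
qed

text \<open>
  Sylow's theorem provides a subgroup of order \<open>r\<close>. The orders of its elements divide both \<open>r\<close> and a power of
  \<open>p\<close>, so the subgroup would be trivial if \<open>r\<close> were different from \<open>p\<close>.
\<close>

lemma prime_dvd_order_imp_eq:
  assumes "finite (carrier G)" "prime (p::nat)" "prime (r::nat)" "r dvd order G"
    and exp: "\<And>x. x \<in> carrier G \<Longrightarrow> x [^] (p ^ b) = \<one>"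
  shows "r = p"
proof (rule ccontr)
  assume "r \<noteq> p"
  hence "coprime r (p ^ b)" using assms by (simp add: primes_coprime)
  obtain k where "order G = r ^ 1 * k" using assms(4) by auto
  then obtain H where H: "subgroup H G" "card H = r"
    using sylow_thm[OF assms(3) is_group _ assms(1)] by (metis power_one_right)
  have "card H \<noteq> 1" using H assms(3) by auto
  have "H \<subseteq> {\<one>}"
  proof
    fix x assume x: "x \<in> H"
    interpret H: group "G\<lparr>carrier := H\<rparr>" using H by (simp add: subgroup_imp_group)
    have xc: "x \<in> carrier G" using x H subgroup.subset by blast
    have "x [^] r = \<one>"
      using H.pow_order_eq_1[of x] x H(2) by (simp add: order_def flip: nat_pow_consistent)
    hence "ord x dvd r" "ord x dvd p ^ b" using exp xc pow_eq_id by auto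
    hence "ord x = 1" using \<open>coprime r (p ^ b)\<close> by (metis coprime_common_divisor_nat)
    thus "x \<in> {\<one>}" using xc ord_eq_1 by blast
  qed
  moreover have "\<one> \<in> H" using H subgroup.one_closed by blast
  ultimately have "H = {\<one>}" by auto
  thus False using \<open>card H \<noteq> 1\<close> by simp
qed

section \<open>Frobenius' theorem for divisors with prime power codivisor\<close>

text \<open>
  Sorting all of \<open>G\<close> by \<open>p\<close>-parts writes the order of \<open>G\<close> as a sum over the \<open>p\<close>-elements \<open>u\<close>. The
  non-central \<open>u\<close> contribute a multiple of \<open>r\<close> by the induction hypothesis for their proper centralizers. Every
  central \<open>u\<close> contributes \<open>root_count G m\<close>, and the number of central \<open>p\<close>-elements is a power of \<open>p\<close>, hence
  coprime to \<open>r\<close>.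
\<close>

lemma dvd_root_count_regular_step:
  fixes p b m r :: nat
  assumes fin: "finite (carrier G)" and p: "prime p" and m: "coprime p m" "m > 0"
    and ord: "order G dvd p ^ b * m" and r: "r dvd order G" "coprime p r"
    and IH: "\<And>u c. u \<in> carrier G \<Longrightarrow> centralizer G u \<noteq> carrier G \<Longrightarrow> c dvd card (centralizer G u) \<Longrightarrow>
      coprime p c \<Longrightarrow> c dvd root_count (G\<lparr>carrier := centralizer G u\<rparr>) m"
  shows "r dvd root_count G m"
proof -
  define q where "q = p ^ b"
  obtain s t where st: "m * s = q * t + 1"
    using prime_power_part_exponent[of q m] m by (auto simp: q_def)
  have dvd: "order G dvd q * m" using ord by (simp add: q_def)
  define U where "U = {u \<in> carrier G. u [^] q = \<one>}"
  define Z where "Z = U \<inter> center G"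
  have sub: "U \<subseteq> carrier G" "Z \<subseteq> U" by (auto simp: U_def Z_def)
  have finU: "finite U" using fin sub finite_subset by blast
  let ?f = "\<lambda>u. root_count (G\<lparr>carrier := centralizer G u\<rparr>) m"
  have "x [^] (m * s) \<in> U" if "x \<in> carrier G" for x
    using part_pow_eq_one_iff[OF dvd st that, of q] that dvd pow_eq_id[OF that]
      ord_dvd_group_order[OF that] by (auto simp: U_def intro: dvd_trans)
  hence "order G = card {x \<in> carrier G. x [^] (m * s) \<in> U}"
    unfolding order_def by (intro arg_cong[where f = card]) auto
  also have "\<dots> = sum ?f U"
    by (rule card_by_parts[OF fin dvd st]) (simp add: U_def)
  also have "\<dots> = sum ?f (U - Z) + sum ?f Z"
    using sum.subset_diff[OF sub(2) finU] .
  finally have total: "order G = sum ?f (U - Z) + sum ?f Z" .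
  have "r dvd sum ?f (U - Z)"
  proof (rule dvd_sum_centralizer_roots[OF fin p r])
    show "U - Z \<subseteq> carrier G" using sub by blast
  next
    fix g u assume gu: "g \<in> carrier G" "u \<in> U - Z"
    hence uc: "u \<in> carrier G" using sub by blast
    have "conj_by G g u \<in> U"
      using gu uc conj_by_pow_eq_one_iff[of g u q] by (simp add: U_def)
    moreover have "conj_by G g u \<notin> center G"
      using conj_by_mem_center_imp[OF gu(1) uc] gu by (auto simp: Z_def)
    ultimately show "conj_by G g u \<in> U - Z" by (simp add: Z_def)
  next
    fix u c assume u: "u \<in> U - Z" and c: "coprime p c" "c dvd card (centralizer G u)"
    have uc: "u \<in> carrier G" using u sub by blast
    show "c dvd ?f u" using IH[OF uc _ c(2,1)] u uc by (auto simp: Z_def center_def)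
  qed
  hence "r dvd sum ?f Z" using r(1) total by (metis dvd_add_right_iff)
  moreover have "sum ?f Z = card Z * root_count G m"
    by (simp add: Z_def center_def root_count_def)
  moreover have "coprime r (card Z)"
  proof (rule ccontr)
    assume "\<not> coprime r (card Z)"
    then obtain l where l: "prime l" "l dvd r" "l dvd card Z"
      unfolding coprime_iff_gcd_eq_1 by (meson gcd_nat.boundedE prime_factor_nat)
    have ZU: "a \<in> carrier G" "a [^] q = \<one>" "a \<in> center G" if "a \<in> Z" for a
      using that by (auto simp: Z_def U_def)
    have sg: "subgroup Z G"
    proof (rule subgroupI)
      have "\<one> \<in> Z" using subgroup.one_closed[OF subgroup_center] by (simp add: Z_def U_def)
      thus "Z \<noteq> {}" by blast
    next
      fix a assume "a \<in> Z"
      note a = ZU[OF this]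
      show "inv a \<in> Z"
        using a(1,2) subgroup.m_inv_closed[OF subgroup_center a(3)] by (simp add: Z_def U_def nat_pow_inv)
    next
      fix a b assume ab: "a \<in> Z" "b \<in> Z"
      note a = ZU[OF ab(1)] and b = ZU[OF ab(2)]
      have "a \<in> centralizer G b" using a(3) b(1) by (simp add: mem_center_iff)
      hence "a \<otimes> b = b \<otimes> a" by (simp add: centralizer_def)
      hence "(a \<otimes> b) [^] q = a [^] q \<otimes> b [^] q" using a(1) b(1) by (intro pow_mult_distrib)
      thus "a \<otimes> b \<in> Z"
        using a(1,2) b(1,2) subgroup.m_closed[OF subgroup_center a(3) b(3)] by (simp add: Z_def U_def)
    qed (use ZU in blast)
    interpret Z: group "G\<lparr>carrier := Z\<rparr>" using sg by (rule subgroup_imp_group)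
    have "l = p"
      using l p finite_subset[OF sub(2) finU]
      by (intro Z.prime_dvd_order_imp_eq[where b = b])
         (auto simp: order_def ZU(2)[unfolded q_def] simp flip: nat_pow_consistent)
    thus False using l p r(2) by (metis coprime_common_divisor dvd_refl not_prime_unit)
  qed
  ultimately show ?thesis by (simp add: coprime_dvd_mult_right_iff)
qed

end

text \<open>
  The solutions of \<open>x ^ m = 1\<close> are the elements of order prime to \<open>p\<close>. The number \<open>m\<close> may be a proper multiple
  of the \<open>p\<close>-free part of the group order, so that it can stay fixed when the induction passes to centralizers.
\<close>

lemma dvd_root_count_regular:
  fixes p b m r :: nat
  assumes "group G" "finite (carrier G)" "prime p" "coprime p m" "m > 0"
    and "order G dvd p ^ b * m" "r dvd order G" "coprime p r"
  shows "r dvd root_count G m"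
  using assms
proof (induction "order G" arbitrary: G r rule: less_induct)
  case less
  show ?case
  proof (rule group.dvd_root_count_regular_step[OF less.prems])
    fix u c
    assume u: "u \<in> carrier G" and ne: "centralizer G u \<noteq> carrier G"
      and c: "c dvd card (centralizer G u)" "coprime p c"
    have sub: "centralizer G u \<subset> carrier G" using ne by (auto simp: centralizer_def)
    have "card (centralizer G u) < order G"
      unfolding order_def using less.prems(2) sub by (rule psubset_card_mono)
    moreover have "card (centralizer G u) dvd order G"
      using group.card_conj_class[OF less.prems(1,2) u] by (metis dvd_triv_right)
    ultimately show "c dvd root_count (G\<lparr>carrier := centralizer G u\<rparr>) m"
      using less.prems c sub group.centralizer_group[OF less.prems(1) u]
      by (intro less.hyps) (auto simp: order_def intro: dvd_trans finite_subset)
  qed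
qed

lemma prime_power_dvd_totient:
  assumes "prime (p::nat)" "p ^ Suc k dvd n"
  shows "p ^ k dvd totient n"
proof -
  have "totient (p ^ Suc k) dvd totient n" using assms(2) by (rule totient_dvd)
  hence "p ^ k * (p - 1) dvd totient n" using assms(1) by (simp only: totient_prime_power_Suc)
  thus ?thesis by (rule dvd_mult_left)
qed

context group
begin

lemma card_same_cyclic_subgroup:
  assumes fin: "finite (carrier G)" and x: "x \<in> carrier G" "ord x > 1"
  shows "card {y \<in> carrier G. generate G {y} = generate G {x}} = totient (ord x)"
proof -
  have pow: "generate G {x} = {x [^] k |k. k \<in> (UNIV :: nat set)}"
    using x by (intro generate_pow_nat) auto
  have "{y \<in> carrier G. generate G {y} = generate G {x}} = (\<lambda>i. x [^] i) ` totatives (ord x)"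
  proof (intro equalityI subsetI)
    fix y assume "y \<in> {y \<in> carrier G. generate G {y} = generate G {x}}"
    hence y: "y \<in> carrier G" "generate G {y} = generate G {x}" by auto
    have "y \<in> generate G {x}" using generate.incl[of y "{y}" G] y by auto
    then obtain i :: nat where i: "y = x [^] i" unfolding pow by auto
    hence red: "y = x [^] (i mod ord x)"
      using x by (metis pow_eq_id mod_mult_div_eq nat_pow_mult nat_pow_closed nat_pow_pow
        nat_pow_one pow_ord_eq_1 r_one)
    have "ord y = ord x" using generate_pow_card y x by metis
    hence cop: "coprime (i mod ord x) (ord x)"
      using pow_ord_eq_ord_iff[OF fin x(1), of "i mod ord x"] red by simp
    have "i mod ord x \<noteq> 0" using cop x(2) by (metis coprime_0_left_iff is_unit_gcd nat_dvd_1_iff_1 less_irrefl)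
    hence "i mod ord x \<in> totatives (ord x)"
      using cop x(2) by (simp add: in_totatives_iff less_imp_le)
    thus "y \<in> (\<lambda>i. x [^] i) ` totatives (ord x)" using red by blast
  next
    fix y assume "y \<in> (\<lambda>i. x [^] i) ` totatives (ord x)"
    then obtain i where i: "i \<in> totatives (ord x)" "y = x [^] i" by auto
    have ordy: "ord y = ord x"
      using pow_ord_eq_ord_iff[OF fin x(1), of i] i by (simp add: in_totatives_iff)
    have yc: "y \<in> carrier G" using i x by simp
    have "y \<in> generate G {x}" using i pow by auto
    hence "generate G {y} \<subseteq> generate G {x}"
      using x generate_is_subgroup[of "{x}"] by (intro generate_subgroup_incl) auto
    moreover have "card (generate G {y}) = card (generate G {x})"
      using ordy generate_pow_card x yc by metis
    moreover have "finite (generate G {x})" using fin x generate_incl[of "{x}"] finite_subset by auto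
    ultimately have "generate G {y} = generate G {x}" by (simp add: card_subset_eq)
    thus "y \<in> {y \<in> carrier G. generate G {y} = generate G {x}}" using yc by simp
  qed
  moreover have "inj_on (\<lambda>i. x [^] i) (totatives (ord x))"
    using ord_inj'[OF x(1)] by (rule inj_on_subset) (auto simp: in_totatives_iff)
  ultimately show ?thesis by (simp add: card_image totient_def)
qed

lemma ord_eq_of_generate_eq:
  "x \<in> carrier G \<Longrightarrow> y \<in> carrier G \<Longrightarrow> generate G {y} = generate G {x} \<Longrightarrow> ord y = ord x"
  by (metis generate_pow_card)

text \<open>
  Downward induction on \<open>k\<close>. The elements counted for \<open>k + 1\<close> but not for \<open>k\<close> are those whose \<open>p\<close>-part has
  order exactly \<open>p ^ (k + 1)\<close>. Their number is divisible by \<open>p ^ k\<close>, because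
  they come in sets of generators of a common cyclic subgroup, whose size is a totient; and by \<open>m\<close>, by sorting
  them according to their \<open>p\<close>-parts.
\<close>

lemma frobenius_prime_power_codivisor:
  fixes p a m k :: nat
  assumes fin: "finite (carrier G)" and p: "prime p" and m: "\<not> p dvd m"
    and ord: "order G = p ^ a * m" and "k \<le> a"
  shows "p ^ k * m dvd root_count G (p ^ k * m)"
  using \<open>k \<le> a\<close>
proof (induction rule: inc_induct)
  case base
  have "x [^] (p ^ a * m) = \<one>" if "x \<in> carrier G" for x
    using pow_order_eq_1[OF that] ord by simp
  hence "root_count G (p ^ a * m) = order G"
    unfolding root_count_def order_def by (intro arg_cong[where f = card]) auto
  thus ?case using ord by simp
next
  case (step k)
  have cop: "coprime p m" using p m by (simp add: prime_imp_coprime)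
  have m0: "m > 0" using m by (cases m) auto
  define X where "X = {x \<in> carrier G. x [^] (p ^ Suc k * m) = \<one> \<and> x [^] (p ^ k * m) \<noteq> \<one>}"
  have finX: "finite X" using fin by (simp add: X_def)
  have Xord: "x \<in> X \<longleftrightarrow> ord x dvd p ^ Suc k * m \<and> \<not> ord x dvd p ^ k * m" if "x \<in> carrier G" for x
    using that pow_eq_id by (simp add: X_def)
  have "root_count G (p ^ Suc k * m) = root_count G (p ^ k * m) + card X"
  proof -
    have "x [^] (p ^ Suc k * m) = \<one>" if "x \<in> carrier G" "x [^] (p ^ k * m) = \<one>" for x
      using that by (simp add: pow_eq_id mult.assoc)
    hence "{x \<in> carrier G. x [^] (p ^ Suc k * m) = \<one>} = {x \<in> carrier G. x [^] (p ^ k * m) = \<one>} \<union> X"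
      unfolding X_def by blast
    moreover have "{x \<in> carrier G. x [^] (p ^ k * m) = \<one>} \<inter> X = {}" by (auto simp: X_def)
    ultimately show ?thesis
      unfolding root_count_def using fin finX by (simp add: card_Un_disjoint)
  qed
  moreover have "p ^ k * m dvd card X"
  proof (rule divides_mult)
    show "p ^ k dvd card X"
    proof -
      have "p ^ k dvd (\<Sum>y\<in>{y\<in>X. generate G {y} = generate G {x}}. 1)" if x: "x \<in> X" for x
      proof -
        have xc: "x \<in> carrier G" using x by (simp add: X_def)
        have big: "p ^ Suc k dvd ord x"
          using prime_power_dvd_of_new_divisor[OF p] x Xord[OF xc] by blast
        have "ord x \<noteq> 1" using x Xord[OF xc] by auto
        moreover have "ord x \<ge> 1" using fin xc by (rule ord_ge_1)
        ultimately have gt: "ord x > 1" by simp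
        have "{y\<in>X. generate G {y} = generate G {x}} = {y\<in>carrier G. generate G {y} = generate G {x}}"
        proof -
          have "y \<in> X" if "y \<in> carrier G" "generate G {y} = generate G {x}" for y
            using ord_eq_of_generate_eq[OF xc that] Xord xc that x by simp
          moreover have "X \<subseteq> carrier G" by (auto simp: X_def)
          ultimately show ?thesis by blast
        qed
        thus ?thesis
          using card_same_cyclic_subgroup[OF fin xc gt] prime_power_dvd_totient[OF p big] by simp
      qed
      thus ?thesis using dvd_sum_by_fibres[OF finX, where f = "\<lambda>_. 1" and h = "\<lambda>x. generate G {x}"] by simp
    qed
    show "m dvd card X"
    proof -
      obtain s t where st: "m * s = p ^ a * t + 1"
        using prime_power_part_exponent[of "p ^ a" m] cop m0 by auto
      have dvd: "order G dvd p ^ a * m" using ord by simp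
      define U where "U = {u \<in> carrier G. u [^] (p ^ Suc k) = \<one> \<and> u [^] (p ^ k) \<noteq> \<one>}"
      have "p ^ Suc k dvd p ^ a" using step by (simp add: le_imp_power_dvd del: power_Suc)
      hence Usub: "U \<subseteq> {u \<in> carrier G. u [^] (p ^ a) = \<one>}"
        by (auto simp: U_def pow_eq_id simp del: power_Suc intro: dvd_trans)
      have "x \<in> X \<longleftrightarrow> x \<in> carrier G \<and> x [^] (m * s) \<in> U" for x
        using part_pow_eq_one_iff[OF dvd st, of x] by (auto simp: X_def U_def simp del: power_Suc)
      hence "card X = card {x \<in> carrier G. x [^] (m * s) \<in> U}"
        by (intro arg_cong[where f = card]) auto
      also have "\<dots> = (\<Sum>u\<in>U. root_count (G\<lparr>carrier := centralizer G u\<rparr>) m)"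
        using fin dvd st Usub by (rule card_by_parts)
      also have "m dvd \<dots>"
      proof (rule dvd_sum_centralizer_roots[OF fin p])
        fix u r assume u: "u \<in> U" and r: "coprime p r" "r dvd card (centralizer G u)"
        have uc: "u \<in> carrier G" using u by (simp add: U_def)
        have "card (centralizer G u) dvd p ^ a * m"
          using card_conj_class[OF fin uc] ord by (metis dvd_triv_right)
        thus "r dvd root_count (G\<lparr>carrier := centralizer G u\<rparr>) m"
          using r fin p cop m0 centralizer_group[OF uc]
          by (intro dvd_root_count_regular[where p = p and b = a])
             (auto simp: order_def centralizer_def)
      qed (use ord cop in \<open>auto simp: U_def conj_by_pow_eq_one_iff simp del: power_Suc\<close>)
      finally show ?thesis .
    qed
    show "coprime (p ^ k) m" using cop by simp
  qed
  moreover have "p ^ k * m dvd root_count G (p ^ Suc k * m)"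
    using step.IH by (metis dvd_mult_right mult.assoc power_Suc)
  ultimately show ?case by (metis dvd_add_left_iff)
qed

section \<open>Root counts in general and in cyclic groups\<close>

lemma root_count_pos: "finite (carrier G) \<Longrightarrow> root_count G d > 0"
  unfolding root_count_def by (auto simp: card_gt_0_iff intro!: exI[of _ \<one>])

lemma root_count_le_order: "finite (carrier G) \<Longrightarrow> root_count G d \<le> order G"
  unfolding root_count_def order_def by (intro card_mono) auto

lemma root_count_ge:
  assumes fin: "finite (carrier G)" and p: "prime p" and "j \<le> multiplicity p (order G)"
  shows "order G div p ^ j \<le> root_count G (order G div p ^ j)"
proof -
  define a where "a = multiplicity p (order G)"
  have "order G \<noteq> 0" using fin order_gt_0_iff_finite by simp
  then obtain m where m: "order G = p ^ a * m" "\<not> p dvd m"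
    unfolding a_def using multiplicity_decompose'[of "order G" p] p not_prime_unit by metis
  have "p ^ a = p ^ j * p ^ (a - j)" using assms(3) by (simp add: a_def flip: power_add)
  hence "order G div p ^ j = p ^ (a - j) * m" using m p prime_gt_0_nat by simp
  moreover have "p ^ (a - j) * m dvd root_count G (p ^ (a - j) * m)"
    using fin p m(2,1) by (rule frobenius_prime_power_codivisor) simp
  ultimately show ?thesis using root_count_pos[OF fin] by (simp add: dvd_imp_le)
qed

lemma cyclic_group_generator:
  assumes fin: "finite (carrier G)" and "cyclic_group G"
  obtains x where "x \<in> carrier G" "ord x = order G"
proof -
  obtain x where x: "x \<in> carrier G" "subgroup_generated G {x} = G"
    using assms(2) by (auto simp: cyclic_group_def)
  thus thesis using that cyclic_order_is_ord by metis
qed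

text \<open>
  With a generator \<open>x\<close> of a group of order \<open>d * e\<close>, the solutions are the \<open>d\<close> powers of \<open>x ^ e\<close>.
\<close>

lemma root_count_cyclic_le:
  assumes fin: "finite (carrier G)" and "cyclic_group G" and d: "d dvd order G"
  shows "root_count G d \<le> d"
proof -
  obtain x where x: "x \<in> carrier G" "ord x = order G"
    using assms cyclic_group_generator by blast
  have n0: "order G > 0" using fin order_gt_0_iff_finite by simp
  have d0: "d > 0" using d n0 by (auto intro: Nat.gr0I)
  define e where "e = order G div d"
  have e: "order G = d * e" using d by (simp add: e_def)
  have "e > 0" using e n0 by (cases e) auto
  have inj: "inj_on (\<lambda>i. x [^] i) {0..order G - 1}" using ord_inj[OF x(1)] x(2) by simp
  have "(\<lambda>i. x [^] i) ` {0..order G - 1} = carrier G"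
  proof (rule card_subset_eq[OF fin])
    show "card ((\<lambda>i. x [^] i) ` {0..order G - 1}) = card (carrier G)"
      using inj n0 by (simp add: card_image order_def)
  qed (use x in auto)
  have "{y \<in> carrier G. y [^] d = \<one>} \<subseteq> (\<lambda>i. x [^] (e * i)) ` {0..<d}"
  proof
    fix y assume "y \<in> {y \<in> carrier G. y [^] d = \<one>}"
    hence y: "y \<in> carrier G" "y [^] d = \<one>" by auto
    then obtain i where i: "y = x [^] i" "i \<in> {0..order G - 1}"
      using \<open>_ = carrier G\<close> by (metis imageE)
    have "x [^] (i * d) = \<one>" using y i x by (simp add: nat_pow_pow)
    hence "d * e dvd i * d" using x e pow_eq_id by metis
    hence "e dvd i" using d0 by (simp add: mult.commute)
    then obtain l where l: "i = e * l" by auto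
    have "i < order G" using i(2) n0 by auto
    hence "i < e * d" using e by (simp add: mult.commute)
    hence "l < d" using l by simp
    thus "y \<in> (\<lambda>i. x [^] (e * i)) ` {0..<d}" using i l by auto
  qed
  hence "root_count G d \<le> card ((\<lambda>i. x [^] (e * i)) ` {0..<d})"
    unfolding root_count_def by (intro card_mono) auto
  also have "\<dots> \<le> d" using card_image_le[of "{0..<d}"] by simp
  finally show ?thesis .
qed

section \<open>Conjugacy into a cyclic Sylow subgroup\<close>

lemma ord_subgroup:
  assumes "subgroup H G"
  shows "group.ord (G\<lparr>carrier := H\<rparr>) x = ord x"
proof -
  interpret H: group "G\<lparr>carrier := H\<rparr>" using assms by (rule subgroup_imp_group)
  show ?thesis unfolding H.ord_def ord_def by (simp flip: nat_pow_consistent)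
qed

lemma conj_by_subgroup:
  assumes "subgroup H G" "g \<in> H"
  shows "conj_by (G\<lparr>carrier := H\<rparr>) g x = conj_by G g x"
  using assms by (simp add: conj_by_def m_inv_consistent)

text \<open>
  Sylow's conjugacy theorem for a cyclic Sylow subgroup \<open>P = \<langle>w\<rangle>\<close>: \<open>\<langle>u\<rangle>\<close> acts on the \<open>m\<close> left cosets of \<open>P\<close> with orbits
  of \<open>p\<close>-power length. As \<open>p\<close> does not divide \<open>m\<close>, some orbit is a single coset \<open>g P\<close>, and \<open>u g P = g P\<close>
  puts \<open>g^-1 u g\<close> into \<open>P\<close>.
\<close>

lemma prime_power_element_conj_into_cyclic_sylow:
  fixes p a m :: nat
  assumes fin: "finite (carrier G)" and p: "prime p" and ord: "order G = p ^ a * m" "\<not> p dvd m"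
    and w: "w \<in> carrier G" "ord w = p ^ a" and u: "u \<in> carrier G" "u [^] (p ^ b) = \<one>"
  obtains g k where "g \<in> carrier G" "conj_by G g u = w [^] (k::nat)"
proof -
  define P where "P = generate G {w}"
  have P: "subgroup P G" "card P = p ^ a"
    unfolding P_def using w generate_is_subgroup[of "{w}"] generate_pow_card[OF w(1)] by simp_all
  have Psub: "P \<subseteq> carrier G" using P(1) subgroup.subset by blast
  have coset_eq: "g <# P = h <# P \<longleftrightarrow> inv g \<otimes> h \<in> P" if "g \<in> carrier G" "h \<in> carrier G" for g h
  proof
    assume "g <# P = h <# P"
    moreover have "h \<in> h <# P" using that(2) subgroup.one_closed[OF P(1)] by (force simp: l_coset_def)
    ultimately obtain y where "y \<in> P" "h = g \<otimes> y" by (auto simp: l_coset_def)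
    thus "inv g \<otimes> h \<in> P" using that Psub by auto
  next
    assume "inv g \<otimes> h \<in> P"
    hence "h \<in> g <# P" using that by (force simp: l_coset_def)
    thus "g <# P = h <# P" using that P(1) by (intro l_repr_independence)
  qed
  define X where "X = (\<lambda>g. g <# P) ` carrier G"
  have finX: "finite X" using fin by (simp add: X_def)
  have "card X * card P = order G"
    unfolding X_def using fin Psub coset_eq by (rule card_image_times_fibre)
  hence "card X = m" using ord P p prime_gt_0_nat by simp
  define K where "K = generate G {u}"
  have K: "subgroup K G" and cardK: "card K = ord u"
    unfolding K_def using u generate_is_subgroup[of "{u}"] generate_pow_card[OF u(1)] by simp_all
  have Ksub: "K \<subseteq> carrier G" using K subgroup.subset by blast
  interpret K: group "G\<lparr>carrier := K\<rparr>" using K by (rule subgroup_imp_group)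
  define orb where "orb = (\<lambda>c. (\<lambda>k. k <# c) ` K)"
  have Xsub: "c \<subseteq> carrier G" if "c \<in> X" for c
    using that Psub by (auto simp: X_def intro: l_coset_subset_G[THEN subsetD])
  have act: "g <# (h <# c) = (g \<otimes> h) <# c" if "c \<in> X" "g \<in> carrier G" "h \<in> carrier G" for c g h
    using Xsub[OF that(1)] that(2,3) by (rule lcos_m_assoc)
  have act1: "\<one> <# c = c" if "c \<in> X" for c using Xsub[OF that] by (rule lcos_mult_one)
  have orbX: "orb c \<subseteq> X" if "c \<in> X" for c
    using that Ksub Psub by (auto simp: orb_def X_def lcos_m_assoc subset_iff)
  have orb_card: "card (orb c) dvd p ^ b" if c: "c \<in> X" for c
  proof -
    have "card ((\<lambda>k. k <# c) ` carrier (G\<lparr>carrier := K\<rparr>)) * card {k \<in> K. k <# c = c}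
        = order (G\<lparr>carrier := K\<rparr>)"
    proof (rule K.card_image_times_fibre)
      fix g h assume "g \<in> carrier (G\<lparr>carrier := K\<rparr>)" "h \<in> carrier (G\<lparr>carrier := K\<rparr>)"
      hence gK: "g \<in> K" "h \<in> K" by auto
      hence gh: "g \<in> carrier G" "h \<in> carrier G" using Ksub by auto
      have "g <# c = h <# c \<longleftrightarrow> inv g <# (g <# c) = inv g <# (h <# c)"
      proof
        assume "inv g <# (g <# c) = inv g <# (h <# c)"
        hence "g <# (inv g <# (g <# c)) = g <# (inv g <# (h <# c))" by simp
        thus "g <# c = h <# c" using gh c by (simp add: act act1)
      qed simp
      also have "\<dots> \<longleftrightarrow> (inv g \<otimes> h) <# c = c" using gh c by (auto simp: act act1)
      also have "\<dots> \<longleftrightarrow> inv g \<otimes> h \<in> {k \<in> K. k <# c = c}"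
        using gK subgroup.m_closed[OF K subgroup.m_inv_closed[OF K gK(1)] gK(2)] by simp
      finally show "g <# c = h <# c \<longleftrightarrow> inv\<^bsub>G\<lparr>carrier := K\<rparr>\<^esub> g \<otimes>\<^bsub>G\<lparr>carrier := K\<rparr>\<^esub> h \<in> {k \<in> K. k <# c = c}"
        using gK K by (simp add: m_inv_consistent)
    qed (use fin Ksub finite_subset in auto)
    hence "card (orb c) * card {k \<in> K. k <# c = c} = ord u"
      by (simp add: orb_def order_def cardK)
    hence "card (orb c) dvd ord u" by (metis dvd_triv_left)
    thus ?thesis using u pow_eq_id by (meson dvd_trans)
  qed
  have self: "c \<in> orb c" if "c \<in> X" for c
    using act1[OF that] subgroup.one_closed[OF K] by (force simp: orb_def)
  have "\<exists>c\<in>X. card (orb c) = 1"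
  proof (rule ccontr)
    assume no: "\<not> (\<exists>c\<in>X. card (orb c) = 1)"
    have "p dvd (\<Sum>c\<in>X. 1)"
    proof (rule dvd_sum_by_fibres[OF finX, where h = orb])
      fix c assume c: "c \<in> X"
      have "orb d = orb c" if d: "d \<in> orb c" for d
      proof -
        obtain h where h: "h \<in> K" "d = h <# c" using d by (auto simp: orb_def)
        have hc: "h \<in> carrier G" using h Ksub by auto
        show ?thesis
          unfolding orb_def
        proof (intro equalityI image_subsetI)
          fix k assume k: "k \<in> K"
          hence "k <# d = (k \<otimes> h) <# c" using h hc Ksub c by (auto simp: act)
          thus "k <# d \<in> (\<lambda>k. k <# c) ` K" using k h(1) subgroup.m_closed[OF K] by blast
        next
          fix k assume k: "k \<in> K"
          hence "k \<in> carrier G" using Ksub by auto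
          hence "k <# c = (k \<otimes> inv h) <# d" using h hc c by (simp add: act m_assoc)
          thus "k <# c \<in> (\<lambda>k. k <# d) ` K"
            using k h(1) subgroup.m_closed[OF K] subgroup.m_inv_closed[OF K] by blast
        qed
      qed
      moreover have "d \<in> orb c" if "d \<in> X" "orb d = orb c" for d using self that by blast
      ultimately have "{d\<in>X. orb d = orb c} = orb c" using orbX[OF c] by blast
      moreover have "p dvd card (orb c)"
        using orb_card[OF c] no c p by (metis divides_primepow_nat dvd_power gr0I power_0)
      ultimately show "p dvd (\<Sum>d\<in>{d\<in>X. orb d = orb c}. 1)" by simp
    qed
    thus False using \<open>card X = m\<close> ord(2) by simp
  qed
  then obtain c where c: "c \<in> X" "card (orb c) = 1" by blast
  have "u \<in> K" using u by (simp add: K_def generate.incl)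
  hence "u <# c \<in> orb c" by (auto simp: orb_def)
  hence fixed: "u <# c = c" using c(2) self[OF c(1)] by (metis card_1_singletonE singletonD)
  obtain g where g: "g \<in> carrier G" "c = g <# P" using c by (auto simp: X_def)
  have "(u \<otimes> g) <# P = g <# P" using fixed g u Psub by (simp add: lcos_m_assoc)
  hence "inv g \<otimes> (u \<otimes> g) \<in> P" using coset_eq[of g "u \<otimes> g"] g u by simp
  moreover have "P = {w [^] k |k. k \<in> (UNIV :: nat set)}"
    unfolding P_def using w p by (intro generate_pow_nat) auto
  ultimately obtain k :: nat where "inv g \<otimes> (u \<otimes> g) = w [^] k" by auto
  hence "conj_by G (inv g) u = w [^] k" using g u by (simp add: conj_by_def m_assoc)
  thus thesis using that[of "inv g" k] g by simp
qed

text \<open>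
  If \<open>H\<close> contains the Sylow subgroup \<open>\<langle>w\<rangle>\<close> of \<open>G\<close>, then \<open>\<langle>w\<rangle>\<close> is a Sylow subgroup of \<open>H\<close>, so the
  conjugating element can be taken in \<open>H\<close>. This is used with \<open>H\<close> a centralizer.
\<close>

lemma conj_into_cyclic_sylow_within_subgroup:
  fixes p a m :: nat
  assumes fin: "finite (carrier G)" and p: "prime p" and ord: "order G = p ^ a * m" "\<not> p dvd m"
    and H: "subgroup H G" and w: "w \<in> H" "ord w = p ^ a" and u: "u \<in> H" "u [^] (p ^ b) = \<one>"
  obtains g k where "g \<in> H" "conj_by G g u = w [^] (k::nat)"
proof -
  interpret H: group "G\<lparr>carrier := H\<rparr>" using H by (rule subgroup_imp_group)
  have Hsub: "H \<subseteq> carrier G" using H subgroup.subset by blast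
  have finH: "finite H" using Hsub fin finite_subset by blast
  have "p ^ a dvd card H"
    using H.ord_dvd_group_order[of w] w ord_subgroup[OF H] by (simp add: order_def)
  then obtain l where l: "card H = p ^ a * l" by auto
  have "card H dvd order G" using lagrange[OF H] by (metis dvd_triv_right)
  hence "l dvd m" using l ord p by simp
  hence "\<not> p dvd l" using ord(2) dvd_trans by blast
  then obtain g k where "g \<in> H" "conj_by (G\<lparr>carrier := H\<rparr>) g u = w [^]\<^bsub>G\<lparr>carrier := H\<rparr>\<^esub> (k::nat)"
    using H.prime_power_element_conj_into_cyclic_sylow[of p a l w u b] finH p l w u ord_subgroup[OF H]
    by (auto simp: order_def simp flip: nat_pow_consistent)
  thus thesis using that conj_by_subgroup[OF H] by (simp flip: nat_pow_consistent)
qed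

lemma pow_mem_centralizer_of_pow:
  assumes "w \<in> carrier G"
  shows "w \<in> centralizer G (w [^] (k::nat))"
  using assms pow_mem_centralizer(2)[of w w k] by (simp add: centralizer_def)

text \<open>
  In the centralizer of \<open>t\<close> the Sylow subgroup \<open>\<langle>t\<rangle>\<close> is central and hence consists of all \<open>p\<close>-elements. Sorting
  the centralizer by \<open>p\<close>-parts therefore gives \<open>p ^ a\<close> fibres of equal size.
\<close>

lemma card_centralizer_of_cyclic_sylow:
  fixes p a m :: nat
  assumes fin: "finite (carrier G)" and p: "prime p" and ord: "order G = p ^ a * m" "\<not> p dvd m"
    and t: "t \<in> carrier G" "ord t = p ^ a"
  shows "card (centralizer G t) = p ^ a * root_count (G\<lparr>carrier := centralizer G t\<rparr>) m"
proof -
  let ?C = "centralizer G t"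
  let ?GC = "G\<lparr>carrier := ?C\<rparr>"
  have C: "subgroup ?C G" using t by (intro subgroup_centralizer)
  interpret C: group ?GC using C by (rule subgroup_imp_group)
  have Csub: "?C \<subseteq> carrier G" by (auto simp: centralizer_def)
  have finC: "finite (carrier ?GC)" using Csub fin finite_subset by auto
  have tC: "t \<in> ?C" using t by (simp add: centralizer_def)
  have m0: "m > 0" using ord(2) by (cases m) auto
  obtain s z where st: "m * s = p ^ a * z + 1"
    using prime_power_part_exponent[of "p ^ a" m] p ord(2) m0 by (auto simp: prime_imp_coprime)
  have dvdG: "card ?C dvd p ^ a * m" using lagrange[OF C] ord(1) by (metis dvd_triv_right)
  hence dvd: "order ?GC dvd p ^ a * m" by (simp add: order_def)
  define U where "U = {v \<in> ?C. v [^] (p ^ a) = \<one>}"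
  have powU: "U = (\<lambda>i. t [^] i) ` {1..p ^ a}"
  proof (intro equalityI subsetI)
    fix v assume v: "v \<in> U"
    hence vC: "v \<in> ?C" "v [^] (p ^ a) = \<one>" by (auto simp: U_def)
    have vc: "v \<in> carrier G" using vC Csub by auto
    obtain g k where g: "g \<in> ?C" "conj_by G g v = t [^] (k::nat)"
      using conj_into_cyclic_sylow_within_subgroup[OF fin p ord C tC t(2) vC] by blast
    have gc: "g \<in> carrier G" using g Csub by auto
    have "conj_by G g t = t" using g gc t conj_by_id_iff by simp
    hence "conj_by G g (t [^] k) = t [^] k" using gc t by (simp add: conj_by_pow)
    hence "v = t [^] k" using g gc vc t conj_by_eq_iff[of g v "t [^] k"] by simp
    hence "v \<in> {t [^] x |x. x \<in> (UNIV::nat set)}" by blast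
    hence "v \<in> {t [^] x |x. x \<in> {0 .. p ^ a - 1}}"
      using ord_elems_inf_carrier[OF t(1)] t(2) p by auto
    then obtain x where x: "v = t [^] x" "x \<le> p ^ a - 1" by auto
    show "v \<in> (\<lambda>i. t [^] i) ` {1..p ^ a}"
    proof (cases "x = 0")
      case True
      hence "v = t [^] (p ^ a)" using x pow_ord_eq_1[OF t(1)] t(2) by simp
      thus ?thesis using p by (auto simp: Suc_leI prime_gt_0_nat)
    next
      case False
      thus ?thesis using x by auto
    qed
  next
    fix v assume "v \<in> (\<lambda>i. t [^] i) ` {1..p ^ a}"
    then obtain i :: nat where i: "v = t [^] i" by auto
    have "t [^] i \<in> ?C" using t tC by (intro pow_mem_centralizer(1))
    moreover have "(t [^] i) [^] (p ^ a) = (t [^] (p ^ a)) [^] i"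
      using t by (simp add: nat_pow_pow mult.commute)
    ultimately show "v \<in> U" using i t pow_ord_eq_1[OF t(1)] by (simp add: U_def)
  qed
  hence cardU: "card U = p ^ a"
    using ord_inj'[OF t(1)] t(2) by (simp add: card_image)
  have cent: "centralizer ?GC v = ?C" if v: "v \<in> U" for v
  proof -
    obtain i :: nat where i: "v = t [^] i" using v powU by auto
    have "g \<otimes> v = v \<otimes> g" if "g \<in> ?C" for g
    proof -
      have "g \<in> carrier G" using that Csub by auto
      hence "t \<in> centralizer G g" using that t centralizer_sym by blast
      hence "v \<in> centralizer G g" using \<open>g \<in> carrier G\<close> unfolding i by (intro pow_mem_centralizer(1))
      thus ?thesis by (simp add: centralizer_def)
    qed
    thus ?thesis by (auto simp: centralizer_def[of ?GC])
  qed
  have inU: "x [^] (m * s) \<in> U" if x: "x \<in> ?C" for x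
  proof -
    have xc: "x \<in> carrier G" using x Csub by auto
    have "ord x dvd p ^ a * m" using ord_dvd_group_order[OF xc] ord by simp
    hence "(x [^] (m * s)) [^] (p ^ a) = \<one>"
      using part_pow_eq_one_iff[of "p ^ a" m s z x "p ^ a"] st ord xc pow_eq_id by simp
    moreover have "x [^] (m * s) \<in> ?C" using t x by (intro pow_mem_centralizer(1))
    ultimately show ?thesis by (simp add: U_def)
  qed
  have "card ?C = card {x \<in> carrier ?GC. x [^]\<^bsub>?GC\<^esub> (m * s) \<in> U}"
    using inU by (intro arg_cong[where f = card]) (auto simp flip: nat_pow_consistent)
  also have "\<dots> = (\<Sum>v\<in>U. root_count (?GC\<lparr>carrier := centralizer ?GC v\<rparr>) m)"
    by (rule C.card_by_parts[OF finC dvd st]) (auto simp: U_def simp flip: nat_pow_consistent)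
  also have "\<dots> = (\<Sum>v\<in>U. root_count ?GC m)"
    using cent by (intro sum.cong) auto
  finally show ?thesis using cardU by simp
qed

section \<open>Absence of fusion\<close>

text \<open>
  Let \<open>n\<close> be the order of \<open>G\<close> and \<open>T\<close> the set of elements of order \<open>p ^ Suc a\<close>. The count says that
  \<open>n - n / p\<close> elements have their \<open>p\<close>-part in \<open>T\<close>; sorting these by \<open>p\<close>-parts determines the sum of the
  centralizer orders over \<open>T\<close>. Each conjugacy class contributes exactly \<open>n\<close> to this sum, so \<open>T\<close> consists of
  \<open>p ^ a * (p - 1)\<close> classes. Each class meets the set of generators of \<open>\<langle>w\<rangle>\<close>, which has just as many
  elements, so no two generators are conjugate.
\<close>

lemma conj_generators_cyclic_sylow_eq:
  fixes p a m :: nat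
  assumes fin: "finite (carrier G)" and p: "prime p" and ord: "order G = p ^ Suc a * m" "\<not> p dvd m"
    and count: "root_count G (p ^ a * m) = p ^ a * m"
    and w: "w \<in> carrier G" "ord w = p ^ Suc a"
    and g: "g \<in> carrier G" "conj_by G g w = w [^] (k::nat)"
  shows "conj_by G g w = w"
proof (rule ccontr)
  assume ne: "conj_by G g w \<noteq> w"
  let ?n = "order G" and ?C = "\<lambda>t. centralizer G t"
  have m0: "m > 0" using ord(2) by (cases m) auto
  have p1: "p > 1" using p prime_gt_1_nat by blast
  obtain s z where st: "m * s = p ^ Suc a * z + 1"
    using prime_power_part_exponent[of "p ^ Suc a" m] p ord(2) m0 by (auto simp: prime_imp_coprime)
  have dvd: "?n dvd p ^ Suc a * m" using ord by simp
  define T where "T = {t \<in> carrier G. ord t = p ^ Suc a}"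
  have ord_iff: "ord t = p ^ Suc a \<longleftrightarrow> t [^] (p ^ Suc a) = \<one> \<and> t [^] (p ^ a) \<noteq> \<one>"
    if "t \<in> carrier G" for t
  proof
    assume "ord t = p ^ Suc a"
    thus "t [^] (p ^ Suc a) = \<one> \<and> t [^] (p ^ a) \<noteq> \<one>"
      using that p1 by (simp add: pow_eq_id dvd_imp_le nat_dvd_not_less)
  next
    assume "t [^] (p ^ Suc a) = \<one> \<and> t [^] (p ^ a) \<noteq> \<one>"
    hence t: "ord t dvd p ^ Suc a" "\<not> ord t dvd p ^ a" using that pow_eq_id by auto
    hence "p ^ Suc a dvd ord t" using prime_power_dvd_of_new_divisor[OF p, of "ord t" a 1] by simp
    thus "ord t = p ^ Suc a" using t(1) by (rule dvd_antisym[rotated])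
  qed

  \<comment> \<open>The orders of the centralizers serve as weights because they give every conjugacy class the same weight \<open>?n\<close>.\<close>
  have "?n - p ^ a * m = card {x \<in> carrier G. x [^] (p ^ a * m) \<noteq> \<one>}"
  proof -
    have "{x \<in> carrier G. x [^] (p ^ a * m) \<noteq> \<one>}
        = carrier G - {x \<in> carrier G. x [^] (p ^ a * m) = \<one>}" by auto
    thus ?thesis using fin count by (simp add: card_Diff_subset order_def root_count_def)
  qed
  also have "{x \<in> carrier G. x [^] (p ^ a * m) \<noteq> \<one>} = {x \<in> carrier G. x [^] (m * s) \<in> T}"
  proof -
    have "x [^] (m * s) \<in> T \<longleftrightarrow> x [^] (p ^ a * m) \<noteq> \<one>" if x: "x \<in> carrier G" for x
    proof -
      have "x [^] (p ^ Suc a * m) = \<one>" using pow_order_eq_1[OF x] ord(1) by simp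
      thus ?thesis
        using part_pow_eq_one_iff[OF dvd st x] ord_iff[of "x [^] (m * s)"] x by (simp add: T_def)
    qed
    thus ?thesis by auto
  qed
  also have "card \<dots> = (\<Sum>t\<in>T. root_count (G\<lparr>carrier := ?C t\<rparr>) m)"
    using fin dvd st by (rule card_by_parts) (auto simp: T_def simp del: power_Suc dest: ord_iff[THEN iffD1, rotated])
  finally have "p ^ Suc a * (?n - p ^ a * m) = (\<Sum>t\<in>T. p ^ Suc a * root_count (G\<lparr>carrier := ?C t\<rparr>) m)"
    by (simp add: sum_distrib_left)
  also have "\<dots> = (\<Sum>t\<in>T. card (?C t))"
    using card_centralizer_of_cyclic_sylow[OF fin p ord] by (intro sum.cong) (auto simp: T_def)
  finally have weight: "p ^ Suc a * (?n - p ^ a * m) = (\<Sum>t\<in>T. card (?C t))" .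

  \<comment> \<open>Every element of \<open>T\<close> is conjugate to one in the set \<open>S\<close> of generators of \<open>\<langle>w\<rangle>\<close>. If \<open>S\<close> contained a conjugate
    \<open>c \<noteq> w\<close> of \<open>w\<close>, the classes of the elements of \<open>S - {c}\<close> would cover \<open>T\<close>, but their number is too small.\<close>
  define S where "S = {y \<in> carrier G. generate G {y} = generate G {w}}"
  have ordw: "ord w > 1" using w(2) p1 by (metis one_less_power zero_less_Suc)
  have cardS: "card S = p ^ a * (p - 1)"
    using card_same_cyclic_subgroup[OF fin w(1) ordw] w(2) p by (simp only: S_def totient_prime_power_Suc)
  have finS: "finite S" using fin by (simp add: S_def)
  have pow_in_S: "w [^] (i::nat) \<in> S" if "ord (w [^] i) = ord w" for i
  proof -
    have "generate G {w [^] i} \<subseteq> generate G {w}"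
    proof (rule generate_subgroup_incl)
      show "subgroup (generate G {w}) G" using w by (intro generate_is_subgroup) auto
      show "{w [^] i} \<subseteq> generate G {w}" using generate_pow_nat[OF w(1)] ordw by auto
    qed
    moreover have "finite (generate G {w})" using fin w generate_incl[of "{w}"] finite_subset by auto
    moreover have "card (generate G {w [^] i}) = card (generate G {w})"
      using that generate_pow_card w by (metis nat_pow_closed)
    ultimately show ?thesis using w by (simp add: S_def card_subset_eq)
  qed
  have ord_conj: "ord (conj_by G h t) = ord t" if "h \<in> carrier G" "t \<in> carrier G" for h t
    using that by (subst ord_unique) (simp_all add: conj_by_pow_eq_one_iff pow_eq_id[of t])
  have S_cl: "card (?C y) = card (?C w) \<and> card (conj_class G y) * card (?C w) = ?n" if y: "y \<in> S" for y
  proof -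
    have yc: "y \<in> carrier G" using y by (simp add: S_def)
    have gen: "generate G {y} = generate G {w}" using y by (simp add: S_def)
    have ordy: "ord y = ord w" using gen generate_pow_card yc w(1) by metis
    have pw: "\<exists>i::nat. b = c [^] i" if "generate G {b} = generate G {c}" "b \<in> carrier G" "c \<in> carrier G" "ord c > 1" for b c
      using generate_pow_nat[OF that(3)] that generate.incl[of b "{b}" G] by auto
    obtain i where i: "y = w [^] (i::nat)" using pw[OF gen yc w(1) ordw] by blast
    obtain j where j: "w = y [^] (j::nat)" using pw[OF gen[symmetric] w(1) yc] ordw ordy by auto
    have "?C b \<subseteq> ?C (b [^] (l::nat))" if "b \<in> carrier G" for b l
    proof
      fix x assume x: "x \<in> ?C b"
      hence xc: "x \<in> carrier G" by (simp add: centralizer_def)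
      hence "b \<in> ?C x" using x that centralizer_sym by blast
      thus "x \<in> ?C (b [^] l)" using xc that pow_mem_centralizer(2)[of x b l] by blast
    qed
    hence "?C y = ?C w" using i j w(1) yc by (metis subset_antisym)
    thus ?thesis using card_conj_class[OF fin yc] by simp
  qed
  define c where "c = conj_by G g w"
  have wS: "w \<in> S" using w by (simp add: S_def)
  have cS: "c \<in> S" using pow_in_S[of k] ord_conj[OF g(1) w(1)] g(2) by (simp add: c_def)
  have cl_c: "conj_class G c = conj_class G w"
    using conj_class_eq_iff[OF w(1), of c] g(1) w(1) unfolding c_def
    by (metis conj_by_closed conj_class_def imageI)
  have T_sub: "T \<subseteq> (\<Union>y\<in>S - {c}. conj_class G y)"
  proof
    fix t assume t: "t \<in> T"
    hence tc: "t \<in> carrier G" "ord t = p ^ Suc a" by (auto simp: T_def)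
    obtain h i where h: "h \<in> carrier G" "conj_by G h t = w [^] (i::nat)"
      using prime_power_element_conj_into_cyclic_sylow[OF fin p ord w tc(1), of "Suc a"] tc ord_iff by metis
    hence "w [^] i \<in> S" using pow_in_S[of i] ord_conj[OF h(1) tc(1)] tc w by simp
    moreover have "t \<in> conj_class G (w [^] i)"
      unfolding conj_class_def using h tc by (intro image_eqI[of _ _ "inv h"]) (simp_all flip: h(2))
    moreover have "w \<in> S - {c}" using wS ne by (auto simp: c_def)
    ultimately show "t \<in> (\<Union>y\<in>S - {c}. conj_class G y)"
      using cl_c by (cases "w [^] i = c") auto
  qed
  have T_C: "card (?C t) = card (?C w)" if t: "t \<in> T" for t
  proof -
    obtain y where y: "y \<in> S" "t \<in> conj_class G y" using t T_sub by blast
    hence yt: "y \<in> carrier G" "t \<in> carrier G" using t by (auto simp: S_def T_def)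
    have "card (conj_class G t) * card (?C t) = card (conj_class G t) * card (?C y)"
      using card_conj_class[OF fin yt(1)] card_conj_class[OF fin yt(2)] conj_class_eq_iff[OF yt] y(2) by simp
    moreover have "card (conj_class G t) > 0"
      using conj_class_self[OF yt(2)] fin by (auto simp: card_gt_0_iff conj_class_def)
    ultimately show ?thesis using S_cl[OF y(1)] by simp
  qed
  have "card T \<le> card (\<Union>y\<in>S - {c}. conj_class G y)"
    using T_sub finS fin by (intro card_mono) (auto simp: conj_class_def)
  also have "\<dots> \<le> (\<Sum>y\<in>S - {c}. card (conj_class G y))"
    using finS by (intro card_UN_le) auto
  finally have "card T * card (?C w) \<le> (\<Sum>y\<in>S - {c}. card (conj_class G y) * card (?C w))"
    by (simp flip: sum_distrib_right)
  also have "\<dots> = (card S - 1) * ?n" using S_cl cS finS by simp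
  finally have "p ^ Suc a * (?n - p ^ a * m) \<le> (p ^ a * (p - 1) - 1) * ?n"
    using weight T_C cardS by simp
  moreover have "p ^ Suc a * (?n - p ^ a * m) = p ^ a * (p - 1) * ?n"
    by (simp add: ord(1) algebra_simps diff_mult_distrib2)
  ultimately have "p ^ a * (p - 1) * ?n \<le> (p ^ a * (p - 1) - 1) * ?n" by (simp only:)
  moreover have "?n > 0" using p1 ord m0 by auto
  ultimately have "p ^ a * (p - 1) \<le> p ^ a * (p - 1) - 1" by (simp only: mult_le_cancel2)
  moreover have "p ^ a * (p - 1) > 0" using p1 by simp
  ultimately show False by linarith
qed

text \<open>
  An instance of Burnside's fusion argument. Let \<open>v\<close> be the conjugate of \<open>u\<close>. Conjugating in \<open>G\<close> brings \<open>v\<close> into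
  \<open>\<langle>w\<rangle>\<close>; conjugating in the centralizer of \<open>v\<close>, which contains \<open>w\<close> and \<open>u\<close>, brings \<open>u\<close> into \<open>\<langle>w\<rangle>\<close> as well. If
  \<open>k\<close> now carries \<open>u\<close> to \<open>v\<close>, then \<open>w\<close> and its conjugate by \<open>k\<close> both centralize \<open>v\<close>, so some \<open>d\<close> in the
  centralizer of \<open>v\<close> brings the latter back into \<open>\<langle>w\<rangle>\<close>. By rigidity \<open>d k\<close> centralizes \<open>w\<close>, hence also \<open>u\<close>;
  as it carries \<open>u\<close> to \<open>v\<close>, the two are equal.
\<close>

lemma cyclic_sylow_no_fusion:
  fixes p a m :: nat
  assumes fin: "finite (carrier G)" and p: "prime p" and ord: "order G = p ^ a * m" "\<not> p dvd m"
    and w: "w \<in> carrier G" "ord w = p ^ a"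
    and rigid: "\<And>g k. g \<in> carrier G \<Longrightarrow> conj_by G g w = w [^] (k::nat) \<Longrightarrow> conj_by G g w = w"
    and u: "u \<in> carrier G" "u [^] (p ^ b) = \<one>"
    and g: "g \<in> carrier G" "conj_by G g u \<in> centralizer G u"
  shows "conj_by G g u = u"
proof -
  define v where "v = conj_by G g u"
  have v: "v \<in> carrier G" "v [^] (p ^ b) = \<one>"
    using u g by (simp_all add: v_def conj_by_pow_eq_one_iff)
  obtain h i where h: "h \<in> carrier G" "conj_by G h v = w [^] (i::nat)"
    using prime_power_element_conj_into_cyclic_sylow[OF fin p ord w v] by blast
  define v1 u1 where "v1 = conj_by G h v" and "u1 = conj_by G h u"
  have c1: "v1 \<in> carrier G" "u1 \<in> carrier G" unfolding v1_def u1_def using h(1) v(1) u(1) by simp_all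
  have "v1 \<in> centralizer G u1"
    using conj_by_centralizer[OF h(1) v(1) u(1)] g(2) by (simp add: v1_def u1_def v_def)
  hence u1: "u1 \<in> centralizer G v1" using c1 centralizer_sym by blast
  have sub: "subgroup (centralizer G v1) G" using c1 by (intro subgroup_centralizer)
  have inC: "x \<in> carrier G" if "x \<in> centralizer G v1" for x using that by (simp add: centralizer_def)
  have wC: "w \<in> centralizer G v1"
    using pow_mem_centralizer_of_pow[OF w(1)] h(2) by (simp add: v1_def)
  have "u1 [^] (p ^ b) = \<one>" using u h by (simp add: u1_def conj_by_pow_eq_one_iff)
  then obtain c j where c: "c \<in> centralizer G v1" "conj_by G c u1 = w [^] (j::nat)"
    using conj_into_cyclic_sylow_within_subgroup[OF fin p ord sub wC w(2) u1] by blast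
  define u2 where "u2 = conj_by G c u1"
  have cc: "c \<in> carrier G" using c inC by blast
  have u2: "u2 \<in> carrier G" using cc c1 by (simp add: u2_def)
  have cv1: "conj_by G c v1 = v1" using c cc c1 conj_by_id_iff by simp
  define k where "k = h \<otimes> g \<otimes> inv h \<otimes> inv c"
  have k: "k \<in> carrier G" using h g cc by (simp add: k_def)
  have "conj_by G k u2 = conj_by G h (conj_by G g (conj_by G (inv h) (conj_by G (inv c) u2)))"
    using h g cc u2 by (simp add: k_def conj_by_mult m_assoc)
  also have "\<dots> = v1" using h g cc c1 u by (simp add: u2_def u1_def v1_def v_def)
  finally have ku2: "conj_by G k u2 = v1" .
  have "w \<in> centralizer G u2" using pow_mem_centralizer_of_pow[OF w(1)] c(2) by (simp add: u2_def)
  hence kw: "conj_by G k w \<in> centralizer G v1"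
    using conj_by_centralizer[OF k w(1) u2] ku2 by simp
  have "conj_by G k w [^] (p ^ a) = \<one>"
    using conj_by_pow_eq_one_iff[OF k w(1)] w pow_ord_eq_1[OF w(1)] by simp
  then obtain d l where d: "d \<in> centralizer G v1" "conj_by G d (conj_by G k w) = w [^] (l::nat)"
    using conj_into_cyclic_sylow_within_subgroup[OF fin p ord sub wC w(2) kw] by blast
  have dc: "d \<in> carrier G" using d inC by blast
  have "conj_by G (d \<otimes> k) w = w [^] l" using d dc k w by (simp add: conj_by_mult)
  hence "conj_by G (d \<otimes> k) w = w" using rigid[of "d \<otimes> k" l] dc k by blast
  hence "conj_by G (d \<otimes> k) u2 = u2" using c(2) dc k w by (simp add: u2_def conj_by_pow)
  moreover have "conj_by G (d \<otimes> k) u2 = v1"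
    using ku2 d dc k u2 c1 conj_by_id_iff[OF dc c1(1)] by (simp flip: conj_by_mult)
  ultimately have "conj_by G c u1 = conj_by G c v1" using cv1 by (simp add: u2_def)
  hence "u1 = v1" using cc c1 conj_by_eq_iff by simp
  hence "u = v" using conj_by_eq_iff[OF h(1) u(1) v(1)] by (simp add: u1_def v1_def)
  thus ?thesis by (simp add: v_def)
qed

text \<open>
  Let \<open>d\<close> be the quotient of \<open>x\<close> and its conjugate. For each prime \<open>p\<close> and the \<open>p\<close>-free part \<open>m\<close> of the
  group order, \<open>x ^ m\<close> is a \<open>p\<close>-element and hence equal to its conjugate, so \<open>d ^ m = 1\<close> and \<open>p\<close> does not divide
  the order of \<open>d\<close>.
\<close>

lemma no_fusion_if_no_local_fusion:
  fixes x g :: 'a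
  assumes fin: "finite (carrier G)"
    and loc: "\<And>p u. prime p \<Longrightarrow> p dvd order G \<Longrightarrow> u \<in> carrier G \<Longrightarrow>
      u [^] (p ^ multiplicity p (order G)) = \<one> \<Longrightarrow> conj_by G g u \<in> centralizer G u \<Longrightarrow> conj_by G g u = u"
    and x: "x \<in> carrier G" and g: "g \<in> carrier G" "conj_by G g x \<in> centralizer G x"
  shows "conj_by G g x = x"
proof -
  let ?y = "conj_by G g x"
  define d where "d = inv x \<otimes> ?y"
  have y: "?y \<in> carrier G" using x g by simp
  have d: "d \<in> carrier G" using x y by (simp add: d_def)
  have n0: "order G \<noteq> 0" using fin order_gt_0_iff_finite by simp
  have "inv x \<in> centralizer G ?y"
    using g x y centralizer_sym subgroup.m_inv_closed[OF subgroup_centralizer[OF y]] by blast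
  hence comm: "inv x \<otimes> ?y = ?y \<otimes> inv x" by (simp add: centralizer_def)
  have "ord d = 1"
  proof (rule ccontr)
    assume "ord d \<noteq> 1"
    then obtain p where p: "prime p" "p dvd ord d" using prime_factor_nat by blast
    have "ord d dvd order G" using d by (rule ord_dvd_group_order)
    hence pn: "p dvd order G" using p dvd_trans by blast
    obtain m where m: "order G = p ^ multiplicity p (order G) * m" "\<not> p dvd m"
      using multiplicity_decompose'[OF n0, of p] p not_prime_unit by metis
    have "conj_by G g (x [^] m) = x [^] m"
    proof (rule loc[OF p(1) pn])
      show "(x [^] m) [^] p ^ multiplicity p (order G) = \<one>"
        using x pow_order_eq_1[OF x] m(1) by (simp add: nat_pow_pow mult.commute)
      have "?y \<in> centralizer G (x [^] m)"
        using pow_mem_centralizer(2)[OF y, of x m] g x y centralizer_sym by blast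
      thus "conj_by G g (x [^] m) \<in> centralizer G (x [^] m)"
        using x g conj_by_pow pow_mem_centralizer(1)[of "x [^] m" ?y m] by simp
    qed (use x in simp)
    hence "?y [^] m = x [^] m" using x g by (simp add: conj_by_pow)
    hence "d [^] m = \<one>" using x y comm by (simp add: d_def pow_mult_distrib nat_pow_inv)
    hence "ord d dvd m" using d pow_eq_id by simp
    thus False using p m(2) dvd_trans by blast
  qed
  hence "inv x \<otimes> ?y = \<one>" using ord_eq_1[OF d] d_def by simp
  thus ?thesis using x y by (metis inv_mult_cancel_left(2) r_one)
qed

section \<open>Groups without fusion are abelian\<close>

text \<open>
  For non-central \<open>x\<close> let \<open>S x\<close> be the union of the classes of the non-central elements of the centralizer \<open>C\<close>
  of \<open>x\<close>. These elements are pairwise non-conjugate, since they commute, and all have centralizer \<open>C\<close>; so with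
  \<open>Z\<close> the center and \<open>n\<close> the order of the group, \<open>S x\<close> has \<open>(|C| - |Z|) * n / |C| \<ge> n / 2\<close> elements. It does
  not exhaust the non-central elements, and another such set \<open>S y\<close> is disjoint from it. Together they
  have at least \<open>n\<close> elements, but the identity lies in neither.
\<close>

lemma abelian_if_centralizers_abelian:
  assumes fin: "finite (carrier G)"
    and nofus: "\<And>x g. x \<in> carrier G \<Longrightarrow> g \<in> carrier G \<Longrightarrow> conj_by G g x \<in> centralizer G x \<Longrightarrow> conj_by G g x = x"
    and ab: "\<And>u x y. u \<in> carrier G - center G \<Longrightarrow> x \<in> centralizer G u \<Longrightarrow> y \<in> centralizer G u \<Longrightarrow> x \<otimes> y = y \<otimes> x"
  shows "center G = carrier G"
proof (rule ccontr)
  assume "center G \<noteq> carrier G"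
  let ?C = "centralizer G" and ?Z = "center G" and ?n = "order G"
  define N where "N = carrier G - ?Z"
  have Zsub: "?Z \<subseteq> carrier G" by (auto simp: center_def)
  have finZ: "finite ?Z" using Zsub fin finite_subset by blast
  have Ncar: "x \<in> carrier G" if "x \<in> N" for x using that by (simp add: N_def)
  have Csub: "?C x \<subseteq> carrier G" for x by (auto simp: centralizer_def)
  have finC: "finite (?C x)" for x using Csub fin finite_subset by blast
  have ZC: "?Z \<subseteq> ?C x" if "x \<in> carrier G" for x using that by (auto simp: mem_center_iff)
  \<comment> \<open>Centralizers of non-central elements are abelian, hence agree as soon as they share such an element.\<close>
  have C_eq: "?C v = ?C u" if u: "u \<in> N" and v: "v \<in> ?C u" "v \<in> N" for u v
  proof -
    have *: "?C a \<subseteq> ?C b" if a: "a \<in> N" and b: "b \<in> ?C a" for a b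
    proof
      fix x assume x: "x \<in> ?C a"
      hence "x \<otimes> b = b \<otimes> x" using ab[of a x b] a b by (simp add: N_def)
      thus "x \<in> ?C b" using x by (simp add: centralizer_def)
    qed
    have "u \<in> ?C v" using u v Ncar centralizer_sym by blast
    thus ?thesis using *[OF u v(1)] *[OF v(2)] by blast
  qed
  define S where "S x = (\<Union>a\<in>?C x - ?Z. conj_class G a)" for x
  have conj_N: "conj_by G g a \<in> N" if "g \<in> carrier G" "a \<in> N" for g a
    using that conj_by_mem_center_imp[of g a] by (auto simp: N_def)
  have C_N: "a \<in> N" if "a \<in> ?C x - ?Z" for a x using that Csub by (auto simp: N_def)
  have S_N: "S x \<subseteq> N" for x using conj_N C_N by (auto simp: S_def conj_class_def)
  have finS: "finite (S x)" for x using finite_subset[OF S_N] fin by (simp add: N_def)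
  have card_S: "card (S x) * card (?C x) = (card (?C x) - card ?Z) * ?n" if x: "x \<in> N" for x
  proof -
    have "card (S x) = (\<Sum>a\<in>?C x - ?Z. card (conj_class G a))"
      unfolding S_def
    proof (rule card_UN_disjoint)
      show "\<forall>a\<in>?C x - ?Z. finite (conj_class G a)" using fin by (simp add: conj_class_def)
      show "\<forall>a\<in>?C x - ?Z. \<forall>b\<in>?C x - ?Z. a \<noteq> b \<longrightarrow> conj_class G a \<inter> conj_class G b = {}"
      proof (intro ballI impI)
        fix a b assume a: "a \<in> ?C x - ?Z" and b: "b \<in> ?C x - ?Z" and ne: "a \<noteq> b"
        show "conj_class G a \<inter> conj_class G b = {}"
        proof (rule ccontr)
          have ac: "a \<in> carrier G" and bc: "b \<in> carrier G" using a b Csub by auto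
          assume "conj_class G a \<inter> conj_class G b \<noteq> {}"
          then obtain y where y: "y \<in> conj_class G a" "y \<in> conj_class G b" by blast
          have "y \<in> carrier G" using y(1) conj_class_subset[OF ac] by blast
          hence "conj_class G a = conj_class G b" using y conj_class_eq_iff ac bc by metis
          hence "b \<in> conj_class G a" using conj_class_self[OF bc] by simp
          then obtain g where g: "g \<in> carrier G" "b = conj_by G g a" by (auto simp: conj_class_def)
          have "b \<in> ?C a" using b C_eq[OF x, of a] a C_N by auto
          thus False using nofus[OF ac g(1)] g(2) ne by simp
        qed
      qed
    qed (use finC in simp)
    also have "\<dots> * card (?C x) = (\<Sum>a\<in>?C x - ?Z. card (conj_class G a) * card (?C x))"
      by (simp add: sum_distrib_right)
    also have "\<dots> = (\<Sum>a\<in>?C x - ?Z. ?n)"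
    proof (rule sum.cong[OF refl])
      fix a assume a: "a \<in> ?C x - ?Z"
      thus "card (conj_class G a) * card (?C x) = ?n"
        using C_eq[OF x, of a] C_N[OF a] card_conj_class[OF fin, of a] Ncar by auto
    qed
    also have "\<dots> = (card (?C x) - card ?Z) * ?n"
      using ZC[OF Ncar[OF x]] finZ by (simp add: card_Diff_subset)
    finally show ?thesis .
  qed
  have half: "?n \<le> 2 * card (S x)" if x: "x \<in> N" for x
  proof -
    have xc: "x \<in> carrier G" using x Ncar by blast
    have xx: "x \<in> ?C x" using xc by (simp add: centralizer_def)
    have "(\<lambda>z. z \<otimes> x) ` ?Z \<subseteq> ?C x - ?Z"
    proof (intro image_subsetI)
      fix z assume z: "z \<in> ?Z"
      have zc: "z \<in> carrier G" using z Zsub by blast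
      have "z \<otimes> x \<in> ?C x" using subgroup.m_closed[OF subgroup_centralizer[OF xc]] ZC[OF xc] z xx by blast
      moreover have "z \<otimes> x \<notin> ?Z"
      proof
        assume "z \<otimes> x \<in> ?Z"
        hence "inv z \<otimes> (z \<otimes> x) \<in> ?Z"
          using z subgroup.m_closed[OF subgroup_center] subgroup.m_inv_closed[OF subgroup_center] by blast
        thus False using x zc xc by (simp add: N_def)
      qed
      ultimately show "z \<otimes> x \<in> ?C x - ?Z" by blast
    qed
    moreover have "inj_on (\<lambda>z. z \<otimes> x) ?Z" by (intro inj_onI) (meson Zsub right_cancel subsetD xc)
    ultimately have "card ?Z \<le> card (?C x - ?Z)"
      using finC by (metis card_inj_on_le finite_Diff)
    also have "\<dots> = card (?C x) - card ?Z" using ZC[OF xc] finZ by (simp add: card_Diff_subset)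
    finally have "card (?C x) \<le> 2 * (card (?C x) - card ?Z)"
      using card_mono[OF finC ZC[OF xc]] by linarith
    hence "card (?C x) * ?n \<le> 2 * (card (?C x) - card ?Z) * ?n" by (rule mult_le_mono1)
    also have "\<dots> = 2 * card (S x) * card (?C x)" using card_S[OF x] by simp
    finally have "?n * card (?C x) \<le> 2 * card (S x) * card (?C x)" by (simp add: mult.commute)
    moreover have "card (?C x) > 0" using xx finC by (auto simp: card_gt_0_iff)
    ultimately show ?thesis by simp
  qed
  have "card ?Z > 0" using subgroup.one_closed[OF subgroup_center] finZ by (auto simp: card_gt_0_iff)
  moreover have "card ?Z \<le> ?n" using Zsub fin unfolding order_def by (rule card_mono[rotated])
  moreover have cardN: "card N = ?n - card ?Z"
    using Zsub finZ by (simp add: N_def card_Diff_subset order_def)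
  ultimately have N_lt: "card N < ?n" "card N + card ?Z = ?n" "card ?Z > 0" by linarith+
  obtain x where x: "x \<in> N" using \<open>center G \<noteq> carrier G\<close> Zsub by (auto simp: N_def)
  have "S x \<noteq> N"
  proof
    assume "S x = N"
    hence "(?n - card ?Z) * card (?C x) = (card (?C x) - card ?Z) * ?n"
      using card_S[OF x] cardN by simp
    hence "?n * card (?C x) - card ?Z * card (?C x) = card (?C x) * ?n - card ?Z * ?n"
      by (simp only: diff_mult_distrib)
    moreover have "card ?Z * card (?C x) \<le> ?n * card (?C x)"
      using \<open>card ?Z \<le> ?n\<close> by simp
    moreover have "card ?Z * ?n \<le> card (?C x) * ?n"
      using card_mono[OF finC ZC[OF Ncar[OF x]]] by simp
    moreover have "?n * card (?C x) = card (?C x) * ?n" by (rule mult.commute)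
    ultimately have "card ?Z * card (?C x) = card ?Z * ?n" by linarith
    hence "card (?C x) = card (carrier G)" using N_lt(3) by (simp add: order_def)
    hence "?C x = carrier G" using card_subset_eq[OF fin Csub] by blast
    thus False using x by (simp add: N_def center_def)
  qed
  then obtain y where y: "y \<in> N" "y \<notin> S x" using S_N by blast
  have "S x \<inter> S y = {}"
  proof (rule ccontr)
    assume "S x \<inter> S y \<noteq> {}"
    then obtain t a b where ab: "a \<in> ?C x - ?Z" "b \<in> ?C y - ?Z" "t \<in> conj_class G a" "t \<in> conj_class G b"
      by (auto simp: S_def)
    have ac: "a \<in> carrier G" and bc: "b \<in> carrier G" using ab Csub by auto
    have "t \<in> carrier G" using ab(3) conj_class_subset[OF ac] by blast
    hence "conj_class G b = conj_class G a" using ab conj_class_eq_iff ac bc by metis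
    hence "b \<in> conj_class G a" using conj_class_self[OF bc] by simp
    then obtain g where g: "g \<in> carrier G" "b = conj_by G g a" by (auto simp: conj_class_def)
    have "?C b = ?C y" using C_eq[OF y(1)] ab(2) C_N by blast
    moreover have "y \<in> ?C y" using y Ncar by (simp add: centralizer_def)
    ultimately have "y \<in> ?C (conj_by G g a)" using g by simp
    hence "conj_by G (inv g) y \<in> ?C a"
      using conj_by_centralizer[of "inv g" y "conj_by G g a"] g ac y Ncar by simp
    also have "?C a = ?C x" using C_eq[OF x] ab(1) C_N by blast
    finally have "conj_by G (inv g) y \<in> ?C x - ?Z" using conj_N[of "inv g" y] g y by (simp add: N_def)
    moreover have "y \<in> conj_class G (conj_by G (inv g) y)"
      unfolding conj_class_def using g y Ncar by (intro image_eqI[of _ _ g]) simp_all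
    ultimately show False using y(2) by (auto simp: S_def)
  qed
  hence "card (S x) + card (S y) = card (S x \<union> S y)" using finS by (simp add: card_Un_disjoint)
  also have "\<dots> \<le> card N" using S_N fin by (intro card_mono) (auto simp: N_def)
  finally show False using half[OF x] half[OF y(1)] N_lt(1) by linarith
qed

end

lemma abelian_if_no_fusion:
  assumes "group G" "finite (carrier G)"
    and "\<And>x g. x \<in> carrier G \<Longrightarrow> g \<in> carrier G \<Longrightarrow> conj_by G g x \<in> centralizer G x \<Longrightarrow> conj_by G g x = x"
  shows "center G = carrier G"
  using assms
proof (induction "order G" arbitrary: G rule: less_induct)
  case less
  show ?case
  proof (rule group.abelian_if_centralizers_abelian[OF less.prems])
    fix u x y
    assume u: "u \<in> carrier G - center G" and xy: "x \<in> centralizer G u" "y \<in> centralizer G u"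
    let ?C = "G\<lparr>carrier := centralizer G u\<rparr>"
    have uc: "u \<in> carrier G" using u by simp
    have sg: "subgroup (centralizer G u) G" using less.prems(1) uc by (rule group.subgroup_centralizer)
    have sub: "centralizer G u \<subset> carrier G" using u by (auto simp: center_def centralizer_def)
    have cent: "centralizer ?C v = centralizer G v \<inter> centralizer G u" for v
      by (auto simp: centralizer_def)
    have "order ?C < order G"
      unfolding order_def using psubset_card_mono[OF less.prems(2) sub] by simp
    hence "center ?C = carrier ?C"
    proof (rule less.hyps)
      show "group ?C" using less.prems(1) uc by (rule group.centralizer_group)
      show "finite (carrier ?C)" using sub less.prems(2) finite_subset by auto
      fix x g assume xg: "x \<in> carrier ?C" "g \<in> carrier ?C" "conj_by ?C g x \<in> centralizer ?C x"
      have eq: "conj_by ?C g x = conj_by G g x" using group.conj_by_subgroup[OF less.prems(1) sg] xg by simp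
      show "conj_by ?C g x = x"
        using xg sub less.prems(3)[of x g] unfolding eq cent by auto
    qed
    hence "centralizer ?C y = centralizer G u" using xy(2) by (auto simp: center_def)
    thus "x \<otimes>\<^bsub>G\<^esub> y = y \<otimes>\<^bsub>G\<^esub> x" using xy(1) unfolding cent by (auto simp: centralizer_def)
  qed
qed

context group
begin

section \<open>Recognizing cyclic groups by root counts\<close>

lemma ord_mult_coprime:
  assumes x: "x \<in> carrier G" and y: "y \<in> carrier G" and comm: "x \<otimes> y = y \<otimes> x"
    and cop: "coprime (ord x) (ord y)"
  shows "ord (x \<otimes> y) = ord x * ord y"
proof (rule dvd_antisym)
  show "ord (x \<otimes> y) dvd ord x * ord y" using comm x y by (rule ord_mul_divides)
  have *: "ord a dvd ord (a \<otimes> b)"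
    if "a \<in> carrier G" "b \<in> carrier G" "a \<otimes> b = b \<otimes> a" "coprime (ord a) (ord b)" for a b
  proof -
    define l where "l = ord (a \<otimes> b) * ord b"
    have "(a \<otimes> b) [^] l = \<one>" "b [^] l = \<one>"
      using that(1,2) by (simp_all only: l_def m_closed pow_eq_id dvd_triv_left dvd_triv_right)
    hence "a [^] l = \<one>"
      using pow_mult_distrib[OF that(3,1,2), of l] that(1) by simp
    hence "ord a dvd ord (a \<otimes> b) * ord b" using that(1) pow_eq_id by (simp only: l_def)
    thus ?thesis using that(4) by (simp add: coprime_dvd_mult_left_iff)
  qed
  have "ord y dvd ord (x \<otimes> y)" using *[OF y x] comm cop by (simp add: coprime_commute)
  thus "ord x * ord y dvd ord (x \<otimes> y)" using *[OF x y comm cop] cop by (intro divides_mult)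
qed

lemma cyclic_if_abelian_with_cyclic_sylows:
  assumes fin: "finite (carrier G)" and ab: "center G = carrier G"
    and syl: "\<And>p. p \<in> prime_factors (order G) \<Longrightarrow> \<exists>w\<in>carrier G. ord w = p ^ multiplicity p (order G)"
  shows "cyclic_group G"
proof -
  let ?n = "order G"
  have n0: "?n > 0" using fin order_gt_0_iff_finite by simp
  have "\<exists>x\<in>carrier G. ord x = (\<Prod>p\<in>F. p ^ multiplicity p ?n)"
    if "finite F" "F \<subseteq> prime_factors ?n" for F
    using that
  proof (induction F rule: finite_induct)
    case empty
    show ?case by (intro bexI[of _ \<one>]) auto
  next
    case (insert q F)
    then obtain x where x: "x \<in> carrier G" "ord x = (\<Prod>p\<in>F. p ^ multiplicity p ?n)" by auto
    obtain w where w: "w \<in> carrier G" "ord w = q ^ multiplicity q ?n" using syl[of q] insert.prems by auto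
    have "coprime (ord w) (ord x)"
      unfolding w(2) x(2) using insert
      by (intro prod_coprime_right coprime_power_left_iff[THEN iffD2] disjI1
          coprime_power_right_iff[THEN iffD2] primes_coprime) auto
    moreover have "w \<in> centralizer G x" using ab w(1) x(1) mem_center_iff by blast
    hence "w \<otimes> x = x \<otimes> w" by (simp add: centralizer_def)
    ultimately have "ord (w \<otimes> x) = ord w * ord x" using w x by (intro ord_mult_coprime)
    thus ?case using insert.hyps w x by (intro bexI[of _ "w \<otimes> x"]) auto
  qed
  from this[of "prime_factors ?n"] obtain x where x: "x \<in> carrier G" "ord x = ?n"
    using prime_factorization_nat[OF n0] by auto
  have "card (carrier (subgroup_generated G {x})) = card (carrier G)"
    using cyclic_order_is_ord[OF x(1)] x(2) by (simp add: order_def)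
  hence "carrier (subgroup_generated G {x}) = carrier G"
    using fin carrier_subgroup_generated_subset by (intro card_subset_eq) auto
  thus ?thesis using x(1) carrier_subgroup_generated_by_singleton cyclic_group by metis
qed

lemma exists_ord_prime_power:
  assumes fin: "finite (carrier G)" and p: "prime p" and ord: "order G = p ^ Suc a * m" "m > 0"
    and count: "root_count G (p ^ a * m) = p ^ a * m"
  obtains w where "w \<in> carrier G" "ord w = p ^ Suc a"
proof -
  have "p > 1" using p by (rule prime_gt_1_nat)
  hence "p ^ a * m < order G" using ord by simp
  hence "{x \<in> carrier G. x [^] (p ^ a * m) = \<one>} \<noteq> carrier G"
    using count by (auto simp: root_count_def order_def)
  then obtain x where x: "x \<in> carrier G" "x [^] (p ^ a * m) \<noteq> \<one>" by auto
  have "ord x dvd p ^ Suc a * m" using ord_dvd_group_order[OF x(1)] ord by simp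
  hence big: "p ^ Suc a dvd ord x"
    using prime_power_dvd_of_new_divisor[OF p] x pow_eq_id by blast
  then obtain l where l: "ord x = p ^ Suc a * l" by auto
  have "l \<noteq> 0" using ord_ge_1[OF fin x(1)] l by (cases l) auto
  hence "ord (x [^] l) = p ^ Suc a" using ord_pow[OF x(1), of l] l by simp
  thus thesis using that[of "x [^] l"] x by simp
qed

lemma cyclic_if_root_counts:
  assumes fin: "finite (carrier G)"
    and count: "\<And>p. p \<in> prime_factors (order G) \<Longrightarrow> root_count G (order G div p) = order G div p"
  shows "cyclic_group G"
proof -
  let ?n = "order G"
  have n0: "?n \<noteq> 0" using fin order_gt_0_iff_finite by simp
  have decomp: "\<exists>a m. ?n = p ^ Suc a * m \<and> \<not> p dvd m \<and> m > 0 \<and> multiplicity p ?n = Suc a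
      \<and> root_count G (p ^ a * m) = p ^ a * m" if p: "prime p" "p dvd ?n" for p
  proof -
    obtain m where m: "?n = p ^ multiplicity p ?n * m" "\<not> p dvd m"
      using multiplicity_decompose'[OF n0, of p] p not_prime_unit by metis
    have "multiplicity p ?n > 0" using p n0 by (simp add: prime_multiplicity_gt_zero_iff)
    then obtain a where a: "multiplicity p ?n = Suc a" by (cases "multiplicity p ?n") auto
    have "?n div p = p ^ a * m" using m(1) p prime_gt_0_nat by (simp add: a mult.assoc)
    moreover have "p \<in> prime_factors ?n" using p n0 by (simp add: in_prime_factors_iff)
    ultimately have "root_count G (p ^ a * m) = p ^ a * m" using count by metis
    moreover have "m > 0" using m by (cases m) auto
    ultimately show ?thesis using m a by auto
  qed
  have "center G = carrier G"
  proof (rule abelian_if_no_fusion[OF is_group fin])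
    fix x g assume xg: "x \<in> carrier G" "g \<in> carrier G" "conj_by G g x \<in> centralizer G x"
    show "conj_by G g x = x"
    proof (rule no_fusion_if_no_local_fusion[OF fin _ xg])
      fix p u
      assume p: "prime p" "p dvd ?n" and u: "u \<in> carrier G" "u [^] (p ^ multiplicity p ?n) = \<one>"
        and gu: "conj_by G g u \<in> centralizer G u"
      obtain a m where am: "?n = p ^ Suc a * m" "\<not> p dvd m" "m > 0" "root_count G (p ^ a * m) = p ^ a * m"
        using decomp[OF p] by blast
      obtain w where w: "w \<in> carrier G" "ord w = p ^ Suc a"
        using exists_ord_prime_power[OF fin p(1) am(1,3,4)] by blast
      show "conj_by G g u = u"
        using cyclic_sylow_no_fusion[OF fin p(1) am(1,2) w _ u xg(2) gu]
          conj_generators_cyclic_sylow_eq[OF fin p(1) am(1,2,4) w] by blast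
    qed
  qed
  thus ?thesis
  proof (rule cyclic_if_abelian_with_cyclic_sylows[OF fin])
    fix p assume "p \<in> prime_factors ?n"
    hence p: "prime p" "p dvd ?n" by (auto simp: in_prime_factors_iff)
    obtain a m where am: "?n = p ^ Suc a * m" "m > 0" "multiplicity p ?n = Suc a"
      "root_count G (p ^ a * m) = p ^ a * m"
      using decomp[OF p] by blast
    show "\<exists>w\<in>carrier G. ord w = p ^ multiplicity p ?n"
      using exists_ord_prime_power[OF fin p(1) am(1,2,4)] am(3) by metis
  qed
qed

end

section \<open>The exponent sum of the product of the element orders\<close>

lemma big_Omega_eq_size: "big_Omega m = size (prime_factorization m)"
  unfolding big_Omega_def size_multiset_overloaded_eq
  by (intro sum.cong) (auto simp: count_prime_factorization in_prime_factors_iff)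

lemma big_Omega_prod:
  assumes "finite A" "\<And>x. x \<in> A \<Longrightarrow> f x \<noteq> 0"
  shows "big_Omega (prod f A) = (\<Sum>x\<in>A. big_Omega (f x))"
  using assms by (induction A rule: finite_induct) (simp_all add: big_Omega_eq_size prime_factorization_mult)

lemma dvd_div_prime_power_iff:
  fixes d n p j :: nat
  assumes n: "n > 0" and p: "prime p" and d: "d dvd n" and j: "j \<le> multiplicity p n"
  shows "d dvd n div p ^ j \<longleftrightarrow> multiplicity p d + j \<le> multiplicity p n"
proof -
  have d0: "d \<noteq> 0" and p0: "p \<noteq> 0" using d n p by (auto intro: Nat.gr0I)
  have pj: "p ^ j dvd n" using j multiplicity_dvd' by blast
  have mult_p: "multiplicity p (d * p ^ j) = multiplicity p d + j"
    using p d0 p0 by (simp add: prime_elem_multiplicity_mult_distrib)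
  have "d dvd n div p ^ j \<longleftrightarrow> d * p ^ j dvd n"
    using pj p0 by (simp add: dvd_div_iff_mult)
  also have "\<dots> \<longleftrightarrow> multiplicity p d + j \<le> multiplicity p n"
  proof
    assume "d * p ^ j dvd n"
    thus "multiplicity p d + j \<le> multiplicity p n"
      using dvd_imp_multiplicity_le[of "d * p ^ j" n p] n mult_p by simp
  next
    assume le: "multiplicity p d + j \<le> multiplicity p n"
    show "d * p ^ j dvd n"
    proof (rule multiplicity_le_imp_dvd)
      fix q :: nat assume q: "prime q"
      show "multiplicity q (d * p ^ j) \<le> multiplicity q n"
      proof (cases "q = p")
        case False
        hence "multiplicity q (p ^ j) = 0" using p q by (simp add: multiplicity_distinct_prime_power)
        hence "multiplicity q (d * p ^ j) = multiplicity q d"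
          using q d0 p0 by (simp add: prime_elem_multiplicity_mult_distrib)
        thus ?thesis using dvd_imp_multiplicity_le[OF d, of q] n by simp
      qed (use le mult_p in simp)
    qed (use d0 p0 in simp)
  qed
  finally show ?thesis .
qed

text \<open>
  The multiplicity \<open>v\<close> of \<open>p\<close> in \<open>d\<close> is the number of \<open>j\<close> between 1 and the multiplicity \<open>a\<close> of \<open>p\<close> in \<open>n\<close> with
  \<open>v + j > a\<close>, that is, for which \<open>d\<close> does not divide \<open>n / p ^ j\<close>.
\<close>

lemma big_Omega_dvd:
  assumes n: "n > 0" and d: "d dvd n"
  shows "big_Omega d = (\<Sum>p\<in>prime_factors n. \<Sum>j=1..multiplicity p n. if d dvd n div p ^ j then 0 else 1)"
proof -
  have "big_Omega d = (\<Sum>p\<in>prime_factors n. multiplicity p d)"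
    unfolding big_Omega_def
  proof (rule sum.mono_neutral_left)
    show "prime_factors d \<subseteq> prime_factors n" using n d by (intro dvd_prime_factors) auto
  qed (auto simp: in_prime_factors_iff not_dvd_imp_multiplicity_0)
  also have "\<dots> = (\<Sum>p\<in>prime_factors n. \<Sum>j=1..multiplicity p n. if d dvd n div p ^ j then 0 else 1)"
  proof (rule sum.cong[OF refl])
    fix p assume "p \<in> prime_factors n"
    hence p: "prime p" by (simp add: in_prime_factors_iff)
    let ?a = "multiplicity p n" and ?v = "multiplicity p d"
    have v: "?v \<le> ?a" using d n by (intro dvd_imp_multiplicity_le) auto
    have "(\<Sum>j=1..?a. if d dvd n div p ^ j then 0 else 1) = (\<Sum>j=1..?a. if j \<in> {?a - ?v + 1..?a} then 1 else (0::nat))"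
    proof (rule sum.cong[OF refl])
      fix j assume j: "j \<in> {1..?a}"
      hence "d dvd n div p ^ j \<longleftrightarrow> ?v + j \<le> ?a"
        using dvd_div_prime_power_iff[OF n p d] by simp
      thus "(if d dvd n div p ^ j then 0 else 1) = (if j \<in> {?a - ?v + 1..?a} then 1 else (0::nat))"
        using j v by auto
    qed
    also have "\<dots> = (\<Sum>j\<in>{?a - ?v + 1..?a}. 1)"
      by (rule sum.mono_neutral_cong_right) auto
    also have "\<dots> = ?v" using v by simp
    finally show "?v = (\<Sum>j=1..?a. if d dvd n div p ^ j then 0 else 1)" ..
  qed
  finally show ?thesis .
qed

lemma (in group) Omega_rho_root_counts:
  assumes fin: "finite (carrier G)"
  shows "Omega_rho G = (\<Sum>p\<in>prime_factors (order G). \<Sum>j=1..multiplicity p (order G).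
    order G - root_count G (order G div p ^ j))"
proof -
  let ?n = "order G"
  have n0: "?n > 0" using fin order_gt_0_iff_finite by simp
  have "Omega_rho G = (\<Sum>x\<in>carrier G. big_Omega (ord x))"
    unfolding Omega_rho_def rho_def using fin ord_ge_1[OF fin] by (intro big_Omega_prod) force+
  also have "\<dots> = (\<Sum>x\<in>carrier G. \<Sum>p\<in>prime_factors ?n. \<Sum>j=1..multiplicity p ?n.
      if ord x dvd ?n div p ^ j then 0 else 1)"
    using n0 ord_dvd_group_order by (intro sum.cong refl big_Omega_dvd)
  also have "\<dots> = (\<Sum>p\<in>prime_factors ?n. \<Sum>x\<in>carrier G. \<Sum>j=1..multiplicity p ?n.
      if ord x dvd ?n div p ^ j then 0 else 1)"
    by (rule sum.swap)
  also have "\<dots> = (\<Sum>p\<in>prime_factors ?n. \<Sum>j=1..multiplicity p ?n. \<Sum>x\<in>carrier G.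
      if ord x dvd ?n div p ^ j then 0 else 1)"
    by (intro sum.cong refl sum.swap)
  also have "\<dots> = (\<Sum>p\<in>prime_factors ?n. \<Sum>j=1..multiplicity p ?n. ?n - root_count G (?n div p ^ j))"
  proof (intro sum.cong refl)
    fix p j
    let ?R = "{x \<in> carrier G. x [^] (?n div p ^ j) = \<one>}"
    have "(\<Sum>x\<in>carrier G. if ord x dvd ?n div p ^ j then 0 else 1) = (\<Sum>x\<in>carrier G - ?R. 1)"
      using fin pow_eq_id by (intro sum.mono_neutral_cong_right) auto
    also have "\<dots> = ?n - root_count G (?n div p ^ j)"
      using fin by (simp add: card_Diff_subset root_count_def order_def)
    finally show "(\<Sum>x\<in>carrier G. if ord x dvd ?n div p ^ j then 0 else 1) = ?n - root_count G (?n div p ^ j)" .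
  qed
  finally show ?thesis .
qed

lemma (in group) Omega_rho_cyclic:
  assumes fin: "finite (carrier G)" and "cyclic_group G"
  shows "Omega_rho G = (\<Sum>p\<in>prime_factors (order G). \<Sum>j=1..multiplicity p (order G).
    order G - order G div p ^ j)"
  unfolding Omega_rho_root_counts[OF fin]
proof (intro sum.cong refl arg_cong2[where f = "(-)"] antisym)
  fix p j assume pj: "p \<in> prime_factors (order G)" "j \<in> {1..multiplicity p (order G)}"
  have "p ^ j dvd order G" using pj by (intro multiplicity_dvd') auto
  hence "order G div p ^ j dvd order G" by (metis dvd_div_mult_self dvd_triv_left)
  thus "root_count G (order G div p ^ j) \<le> order G div p ^ j"
    using assms by (intro root_count_cyclic_le)
  show "order G div p ^ j \<le> root_count G (order G div p ^ j)"
    using pj by (intro root_count_ge[OF fin]) (auto simp: in_prime_factors_iff)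
qed

lemma cyclic_integer_mod_group: "cyclic_group (integer_mod_group n)"
proof (cases "n = 0")
  case True
  thus ?thesis by (simp add: integer_mod_group_def)
next
  case False
  have "carrier (integer_mod_group n) = range (\<lambda>i::int. (1 mod int n) [^]\<^bsub>integer_mod_group n\<^esub> i)"
  proof (intro equalityI subsetI)
    fix x assume "x \<in> carrier (integer_mod_group n)"
    hence "x = x mod int n" using False by (simp add: carrier_integer_mod_group)
    hence "x = (1 mod int n) [^]\<^bsub>integer_mod_group n\<^esub> x"
      by (simp add: int_pow_integer_mod_group mod_mult_right_eq)
    thus "x \<in> range (\<lambda>i::int. (1 mod int n) [^]\<^bsub>integer_mod_group n\<^esub> i)" by blast
  qed (use False in \<open>auto simp: carrier_integer_mod_group int_pow_integer_mod_group\<close>)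
  moreover have "1 mod int n \<in> carrier (integer_mod_group n)"
    using False by (simp add: carrier_integer_mod_group)
  ultimately show ?thesis using group.cyclic_group[OF group_integer_mod_group] by blast
qed

section \<open>Comparison with the cyclic group\<close>

theorem theorem2p7:
  fixes G :: "('a, 'b) monoid_scheme" and n :: nat
  assumes "group G" and "finite (carrier G)" and "order G = n"
  shows "Omega_rho G \<le> Omega_rho (integer_mod_group n) \<and>
    (Omega_rho G = Omega_rho (integer_mod_group n) \<longleftrightarrow> cyclic_group G)"
proof -
  interpret group G by fact
  note fin = \<open>finite (carrier G)\<close> and n = \<open>order G = n\<close>
  have n0: "n > 0" using fin n order_gt_0_iff_finite by simp
  let ?Z = "integer_mod_group n" and ?P = "prime_factors n" and ?J = "\<lambda>p. {1..multiplicity p n}"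
  have finZ: "finite (carrier ?Z)" "order ?Z = n"
    using n0 by (simp_all add: carrier_integer_mod_group order_def)
  have Z: "Omega_rho ?Z = (\<Sum>p\<in>?P. \<Sum>j\<in>?J p. n - n div p ^ j)"
    using group.Omega_rho_cyclic[OF group_integer_mod_group finZ(1) cyclic_integer_mod_group] finZ(2) by simp
  have G: "Omega_rho G = (\<Sum>p\<in>?P. \<Sum>j\<in>?J p. n - root_count G (n div p ^ j))"
    using Omega_rho_root_counts[OF fin] n by simp
  have term_le: "n - root_count G (n div p ^ j) \<le> n - n div p ^ j" if "p \<in> ?P" "j \<in> ?J p" for p j
    using root_count_ge[OF fin, of p j] that n by (intro diff_le_mono2) (auto simp: in_prime_factors_iff)
  have le: "Omega_rho G \<le> Omega_rho ?Z"
    unfolding Z G by (intro sum_mono term_le)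
  have "cyclic_group G" if eq: "Omega_rho G = Omega_rho ?Z"
  proof (rule cyclic_if_root_counts[OF fin])
    fix p assume "p \<in> prime_factors (order G)"
    hence p: "p \<in> ?P" using n by simp
    hence pp: "prime p" "p dvd n" by (auto simp: in_prime_factors_iff)
    have sums: "(\<Sum>j\<in>?J p. n - root_count G (n div p ^ j)) = (\<Sum>j\<in>?J p. n - n div p ^ j)"
      using eq unfolding Z G
      by (rule sum_mono_inv) (use p in \<open>auto simp only: finite_set_mset intro!: sum_mono term_le\<close>)
    have one: "1 \<in> ?J p" using pp n0 by (simp add: prime_multiplicity_gt_zero_iff Suc_leI)
    have "n - root_count G (n div p) = n - n div p"
      using sum_mono_inv[OF sums term_le[OF p] one] by simp
    moreover have "root_count G (n div p) \<le> n" using root_count_le_order[OF fin] n by simp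
    moreover have "n div p \<le> n" by (rule div_le_dividend)
    ultimately have "root_count G (n div p) = n div p" by linarith
    thus "root_count G (order G div p) = order G div p" using n by simp
  qed
  moreover have "Omega_rho G = Omega_rho ?Z" if "cyclic_group G"
    using Omega_rho_cyclic[OF fin that] Z n by simp
  ultimately show ?thesis using le by blast
qed

end
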